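(* Let $E$ be a real Fréchet space with an unconditional Schauder basis $\{e_k\}_{k\in\mathbb{N}}$ and the associated partial order $\ll$, let $T>0$, $I_T=[0,T]$, $\hat x\in E$, and let $f:I_T\times E\to E$, $f(t,x)=\sum_{k=1}^\infty f_k(t,x)e_k$, satisfy: (i) for every $k\in\mathbb{N}$ and every fixed $t\in I_T$ the function $f_k(t,\cdot):E\to\mathbb{R}$ is left continuous; (ii) for every fixed $x\in E$ the function $t\mapsto f(t,x)$ is integrable on $I_T$; (iii) there exists $C\in E$ such that $f(t,x)\ll C$ for all $(t,x)\in I_T\times E$; (iv) there exists $x_*\in E$ such that $x_*\ll \hat x+\int_0^t f(\xi,x_* )\,d\xi$ for all $t\in I_T$; (v) $f$ is monotone: for all $x,y\in E$ and all $t\in I_T$, $x\ll y$ implies $f(t,x)\ll f(t,y)$. Then the initial value problem $\dot x(t)=f(t,x(t))$, $x(0)=\hat x$, has a solution $x\in C(I_T,E)$.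
   Context: The topology of the Fréchet space $E$ (Hausdorff, complete) is defined by a countable family of seminorms $\{\|\cdot\|_n\}_{n\in\mathbb{N}}$. A sequence $\{e_k\}_{k\in\mathbb{N}}\subset E$ is a Schauder basis if for every $x\in E$ there is a unique sequence of scalars $\{x_k\}$ with $x=\sum_{k=1}^\infty x_ke_k$ (convergence in the topology of $E$). It is unconditional if for every $x\in E$ and every permutation $\pi:\mathbb{N}\to\mathbb{N}$ the series $\sum_k x_{\pi(k)}e_{\pi(k)}$ converges to the same element $x$. Partial order: for $x=\sum x_ke_k$, $y=\sum y_ke_k$ in $E$, $x\ll y$ means $x_i\le y_i$ for all $i\in\mathbb{N}$. A function $g:E\to\mathbb{R}$ is left continuous if for every $x'\in E$ and every sequence $x_k\to x'$ in $E$ with $x_k\ll x_{k+1}$ for all $k\in\mathbb{N}$, one has $\lim_{k\to\infty}g(x_k)=g(x')$. Integrability: $I_T$ carries Lebesgue measure $\mu$. A step function $h:I_T\to E$ is a function with finitely many values $a_1,\dots,a_\nu$, each level set $A_k=h^{-1}(a_k)$ being measurable; its integral is $\sum_{a_k\neq0}a_k\mu(A_k)$. A function $g:I_T\to E$ is integrable if there is a sequence of step functions $h_n$ with $h_n\to g$ almost everywhere and, for every $s\in\mathbb{N}$, $\int\|h_n-h_m\|_s\to0$ as $n,m\to\infty$; then $\int g:=\lim_n\int h_n$ (limit in $E$, independent of the choice of $h_n$). Solution: a function $x\in C(I_T,E)$ is a solution of the initial value problem if $t\mapsto f(t,x(t))$ is integrable on $I_T$ and $x(t)=\hat x+\int_0^t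 f(\xi,x(\xi))\,d\xi$ for all $t\in I_T$. *)

theory Defs
  imports "HOL-Analysis.Analysis"
begin

definition seminorm :: "('a::real_vector \<Rightarrow> real) \<Rightarrow> bool" where
  "seminorm q \<longleftrightarrow>
     (\<forall>x y. q (x + y) \<le> q x + q y) \<and> (\<forall>c x. q (c *\<^sub>R x) = \<bar>c\<bar> * q x)"

text \<open>The space \<open>E\<close> is the whole type \<open>'a\<close>; its topology is the type class topology,
  Hausdorff by the sort \<open>t2_space\<close>. The assumption \<open>open_iff\<close> says that this topology is the one
  generated by the seminorms \<open>p n\<close>. As this topology is metrizable, sequential completeness is
  completeness.\<close>

locale frechet_space =
  fixes p :: "nat \<Rightarrow> 'a::{real_vector, t2_space} \<Rightarrow> real"
  assumes seminorm: "seminorm (p n)"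
    and open_iff: "open U \<longleftrightarrow>
      (\<forall>x\<in>U. \<exists>N \<epsilon>. finite N \<and> \<epsilon> > 0 \<and> {y. \<forall>n\<in>N. p n (y - x) < \<epsilon>} \<subseteq> U)"
    and complete:
      "(\<And>s. ((\<lambda>(m, n). p s (X m - X n)) \<longlongrightarrow> 0) (sequentially \<times>\<^sub>F sequentially)) \<Longrightarrow>
       convergent X"

definition schauder_basis :: "(nat \<Rightarrow> 'a::{real_vector, t2_space}) \<Rightarrow> bool" where
  "schauder_basis e \<longleftrightarrow> (\<forall>x. \<exists>!c :: nat \<Rightarrow> real. (\<lambda>k. c k *\<^sub>R e k) sums x)"

definition coord :: "(nat \<Rightarrow> 'a::{real_vector, t2_space}) \<Rightarrow> 'a \<Rightarrow> nat \<Rightarrow> real" where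
  "coord e x = (THE c. (\<lambda>k. c k *\<^sub>R e k) sums x)"

definition unconditional_schauder_basis :: "(nat \<Rightarrow> 'a::{real_vector, t2_space}) \<Rightarrow> bool" where
  "unconditional_schauder_basis e \<longleftrightarrow> schauder_basis e \<and>
     (\<forall>x \<pi>. bij \<pi> \<longrightarrow> (\<lambda>k. coord e x (\<pi> k) *\<^sub>R e (\<pi> k)) sums x)"

definition basis_le :: "(nat \<Rightarrow> 'a::{real_vector, t2_space}) \<Rightarrow> 'a \<Rightarrow> 'a \<Rightarrow> bool" where
  "basis_le e x y \<longleftrightarrow> (\<forall>i. coord e x i \<le> coord e y i)"

definition left_continuous ::
    "(nat \<Rightarrow> 'a::{real_vector, t2_space}) \<Rightarrow> ('a \<Rightarrow> real) \<Rightarrow> bool" where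
  "left_continuous e g \<longleftrightarrow>
     (\<forall>x' X. X \<longlonglongrightarrow> x' \<and> (\<forall>k. basis_le e (X k) (X (Suc k))) \<longrightarrow>
        (\<lambda>k. g (X k)) \<longlonglongrightarrow> g x')"

text \<open>Step functions are the library's \<open>simple_function\<close>s, and \<open>simple_bochner_integral\<close>
  is their elementary integral (the value 0 contributes nothing to the sum).
  The set \<open>S\<close> is meant to be measurable of finite measure: then each \<open>p s (h m t - h n t)\<close> is
  bounded and measurable in \<open>t\<close>, so the integral in the third condition is a genuine one.\<close>

definition approx_by_steps ::
    "(nat \<Rightarrow> 'a::{real_vector, t2_space} \<Rightarrow> real) \<Rightarrow> real set \<Rightarrow> (real \<Rightarrow> 'a) \<Rightarrow>
     (nat \<Rightarrow> real \<Rightarrow> 'a) \<Rightarrow> bool" where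
  "approx_by_steps p S g h \<longleftrightarrow>
     (\<forall>n. simple_function (lebesgue_on S) (h n)) \<and>
     (AE t in lebesgue_on S. (\<lambda>n. h n t) \<longlonglongrightarrow> g t) \<and>
     (\<forall>s. ((\<lambda>(m, n). LINT t|lebesgue_on S. p s (h m t - h n t)) \<longlongrightarrow> 0)
            (sequentially \<times>\<^sub>F sequentially))"

definition frechet_integrable ::
    "(nat \<Rightarrow> 'a::{real_vector, t2_space} \<Rightarrow> real) \<Rightarrow> real set \<Rightarrow> (real \<Rightarrow> 'a) \<Rightarrow> bool" where
  "frechet_integrable p S g \<longleftrightarrow> (\<exists>h. approx_by_steps p S g h)"

definition frechet_integral ::
    "(nat \<Rightarrow> 'a::{real_vector, t2_space} \<Rightarrow> real) \<Rightarrow> real set \<Rightarrow> (real \<Rightarrow> 'a) \<Rightarrow> 'a" where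
  "frechet_integral p S g =
     (THE y. \<exists>h. approx_by_steps p S g h \<and>
        (\<lambda>n. Bochner_Integration.simple_bochner_integral (lebesgue_on S) (h n)) \<longlonglongrightarrow> y)"

definition ivp_solution ::
    "(nat \<Rightarrow> 'a::{real_vector, t2_space} \<Rightarrow> real) \<Rightarrow> real \<Rightarrow> (real \<Rightarrow> 'a \<Rightarrow> 'a) \<Rightarrow> 'a \<Rightarrow>
     (real \<Rightarrow> 'a) \<Rightarrow> bool" where
  "ivp_solution p T f x0 x \<longleftrightarrow>
     continuous_on {0..T} x \<and>
     frechet_integrable p {0..T} (\<lambda>t. f t (x t)) \<and>
     (\<forall>t\<in>{0..T}. x t = x0 + frechet_integral p {0..t} (\<lambda>\<xi>. f \<xi> (x \<xi>)))"

end

theory Submission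
  imports Defs
begin

text \<open>The solution is the limit of the Picard iterates
  \<open>X\<^sub>0 = xs\<close>, \<open>X\<^sub>n\<^sub>+\<^sub>1(t) = x0 + \<integral>\<^sub>0\<^sup>t f(\<xi>, X\<^sub>n(\<xi>)) d\<xi>\<close> started at the subsolution \<open>xs\<close>. As \<open>f\<close> and the
  integral are monotone, the iterates increase, and they stay below \<open>x0 + T C\<close> once \<open>C\<close> has been
  replaced by an element with nonnegative coordinates. In each coordinate they therefore converge,
  left continuity carries \<open>f\<close> along, and dominated convergence on the line shows that the limit is
  a fixed point. Three ingredients make this argument work in the Frechet space.

  \<^item> Order intervals behave as if they were compact. Unconditional convergence makes the tails
    \<open>\<Sum>k\<in>F. c k e\<^sub>k\<close>, \<open>F\<close> finite and far out, uniformly small as long as \<open>\<bar>c k\<bar>\<close> is dominated by the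
    coordinates of a fixed element. So coordinates that are dominated belong to an element
    (\<open>dominated_coords_exist\<close>), and coordinatewise convergence under such a bound is convergence in
    the space (\<open>tendsto_if_dominated_coords\<close>).

  \<^item> The integral is determined by its coordinates. The seminorm \<open>usem n x\<close>, the supremum of
    the values of a seminorm on all finite subsums of the expansion of \<open>x\<close>, is continuous; this is
    an open mapping argument (\<open>usem_le_psum\<close>) resting on completeness. Hence coordinates are
    continuous, integrable functions have integrable coordinates, the coordinates of the integral
    are the integrals of the coordinates (\<open>coord_frechet_integral\<close>), and conversely a function with
    measurable coordinates is integrable as soon as each \<open>usem i\<close> of it has an integrable bound
    (\<open>frechet_integrableI\<close>).

  \<^item> The superposition \<open>t \<mapsto> f(t, X(t))\<close> is measurable for every iterate
    (\<open>measurable_picard_superposition\<close>). Left continuity only controls increasing sequences, so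
    \<open>X\<close> must be approximated from below in the order by step functions. This is possible since
    \<open>X(t) - t C\<close> decreases in every coordinate: on a dyadic interval \<open>[a, b]\<close> the constant
    \<open>X(b) - (b - a) C\<close> lies below \<open>X\<close>, and these constants increase under refinement.\<close>

section \<open>Seminorms\<close>

lemma seminorm_add: "seminorm q \<Longrightarrow> q (x + y) \<le> q x + q y"
  and seminorm_scaleR: "seminorm q \<Longrightarrow> q (c *\<^sub>R x) = \<bar>c\<bar> * q x"
  by (auto simp: seminorm_def)

lemma seminorm_0: "seminorm q \<Longrightarrow> q 0 = 0"
  using seminorm_scaleR[of q 0 0] by simp

lemma seminorm_minus: "seminorm q \<Longrightarrow> q (- x) = q x"
  using seminorm_scaleR[of q "-1" x] by simp

lemma seminorm_nonneg: "seminorm q \<Longrightarrow> 0 \<le> q x"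
  using seminorm_add[of q x "- x"] by (simp add: seminorm_0 seminorm_minus)

lemma seminorm_diff_commute: "seminorm q \<Longrightarrow> q (x - y) = q (y - x)"
  using seminorm_minus[of q "x - y"] by simp

lemma seminorm_diff: "seminorm q \<Longrightarrow> q (x - y) \<le> q x + q y"
  using seminorm_add[of q x "- y"] by (simp add: seminorm_minus)

lemma seminorm_triangle: "seminorm q \<Longrightarrow> q (x - z) \<le> q (x - y) + q (y - z)"
  using seminorm_add[of q "x - y" "y - z"] by simp

lemma seminorm_abs_diff: "seminorm q \<Longrightarrow> \<bar>q x - q y\<bar> \<le> q (x - y)"
  using seminorm_triangle[of q x 0 y] seminorm_triangle[of q y 0 x] seminorm_diff_commute[of q x y]
  by simp

lemma seminorm_sum: "seminorm q \<Longrightarrow> q (sum f A) \<le> (\<Sum>a\<in>A. q (f a))"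
proof (induction A rule: infinite_finite_induct)
  case (insert a A)
  then show ?case using seminorm_add[of q "f a" "sum f A"] by simp
qed (simp_all add: seminorm_0)

text \<open>A weighted sum with weights in \<open>[0,1]\<close> is a convex combination of the unweighted partial
  sums, so a convex function is largest at one of the latter. The offset \<open>u\<close> is what makes the
  induction on \<open>F\<close> work.\<close>

lemma seminorm_weighted_sum_le:
  fixes a :: "'i \<Rightarrow> real"
  assumes q: "seminorm q" and "finite F" and "\<And>k. k \<in> F \<Longrightarrow> 0 \<le> a k \<and> a k \<le> 1"
    and "\<And>G. G \<subseteq> F \<Longrightarrow> q (u + (\<Sum>k\<in>G. v k)) \<le> M"
  shows "q (u + (\<Sum>k\<in>F. a k *\<^sub>R v k)) \<le> M"
  using assms(2-)
proof (induction F arbitrary: u rule: finite_induct)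
  case empty
  then show ?case by (metis order_refl sum.empty)
next
  case (insert i F)
  define S where "S = (\<Sum>k\<in>F. a k *\<^sub>R v k)"
  have 1: "q (u + S) \<le> M" unfolding S_def
    by (rule insert.IH) (use insert.prems in auto)
  have 2: "q (u + v i + S) \<le> M" unfolding S_def
  proof (rule insert.IH)
    fix G assume G: "G \<subseteq> F"
    then have "i \<notin> G" "finite G" using insert.hyps finite_subset by auto
    then show "q (u + v i + sum v G) \<le> M"
      using insert.prems(2)[of "insert i G"] G by (auto simp: add.assoc)
  qed (use insert.prems in auto)
  have a: "0 \<le> a i" "a i \<le> 1" using insert.prems(1)[of i] by auto
  have eq: "u + (\<Sum>k\<in>insert i F. a k *\<^sub>R v k) = (1 - a i) *\<^sub>R (u + S) + a i *\<^sub>R (u + v i + S)"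
    using insert.hyps by (simp add: S_def algebra_simps)
  have "q (u + (\<Sum>k\<in>insert i F. a k *\<^sub>R v k)) \<le> (1 - a i) * q (u + S) + a i * q (u + v i + S)"
    using seminorm_add[OF q, of "(1 - a i) *\<^sub>R (u + S)" "a i *\<^sub>R (u + v i + S)"] a
    unfolding eq seminorm_scaleR[OF q] by simp
  also have "\<dots> \<le> (1 - a i) * M + a i * M"
    using a 1 2 by (intro add_mono mult_left_mono) auto
  finally show ?case by (simp add: algebra_simps)
qed

text \<open>The factor 2 comes from treating the terms whose coefficients have equal signs and
  those whose coefficients have opposite signs separately.\<close>

lemma seminorm_dominated_sum_le:
  fixes c d :: "'i \<Rightarrow> real"
  assumes q: "seminorm q" and F: "finite F" and le: "\<And>k. k \<in> F \<Longrightarrow> \<bar>c k\<bar> \<le> \<bar>d k\<bar>"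
    and M: "\<And>G. G \<subseteq> F \<Longrightarrow> q (\<Sum>k\<in>G. d k *\<^sub>R v k) \<le> M"
  shows "q (\<Sum>k\<in>F. c k *\<^sub>R v k) \<le> 2 * M"
proof -
  define a where "a k = c k / d k" for k
  have c: "c k = a k * d k" if "k \<in> F" for k
    using le[OF that] by (cases "d k = 0") (auto simp: a_def)
  have a: "\<bar>a k\<bar> \<le> 1" if "k \<in> F" for k
    using le[OF that] by (cases "d k = 0") (auto simp: a_def abs_divide)
  have *: "q (\<Sum>k\<in>H. \<bar>a k\<bar> *\<^sub>R (d k *\<^sub>R v k)) \<le> M" if "H \<subseteq> F" for H
  proof -
    have "q (0 + (\<Sum>k\<in>H. \<bar>a k\<bar> *\<^sub>R (d k *\<^sub>R v k))) \<le> M"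
    proof (rule seminorm_weighted_sum_le[OF q finite_subset[OF that F]])
      show "q (0 + (\<Sum>k\<in>G. d k *\<^sub>R v k)) \<le> M" if "G \<subseteq> H" for G
        using M[of G] that \<open>H \<subseteq> F\<close> by simp
    qed (use a \<open>H \<subseteq> F\<close> in auto)
    then show ?thesis by simp
  qed
  let ?p = "{k\<in>F. 0 \<le> a k}" and ?n = "{k\<in>F. a k < 0}"
  have "(\<Sum>k\<in>F. c k *\<^sub>R v k) = (\<Sum>k\<in>?p. c k *\<^sub>R v k) + (\<Sum>k\<in>?n. c k *\<^sub>R v k)"
    by (subst sum.union_disjoint[symmetric]) (use F in \<open>auto intro!: sum.cong\<close>)
  moreover have "(\<Sum>k\<in>?p. c k *\<^sub>R v k) = (\<Sum>k\<in>?p. \<bar>a k\<bar> *\<^sub>R (d k *\<^sub>R v k))"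
    by (rule sum.cong) (auto simp: c)
  moreover have "(\<Sum>k\<in>?n. c k *\<^sub>R v k) = - (\<Sum>k\<in>?n. \<bar>a k\<bar> *\<^sub>R (d k *\<^sub>R v k))"
    unfolding sum_negf[symmetric] by (rule sum.cong) (auto simp: c)
  ultimately have eq: "(\<Sum>k\<in>F. c k *\<^sub>R v k) =
      (\<Sum>k\<in>?p. \<bar>a k\<bar> *\<^sub>R (d k *\<^sub>R v k)) - (\<Sum>k\<in>?n. \<bar>a k\<bar> *\<^sub>R (d k *\<^sub>R v k))"
    by simp
  have "q (\<Sum>k\<in>F. c k *\<^sub>R v k) \<le> M + M" unfolding eq
    by (rule order_trans[OF seminorm_diff[OF q] add_mono[OF * *]]) auto
  then show ?thesis by simp
qed

section \<open>Convergence in a Frechet space\<close>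

context frechet_space
begin

lemma tendsto_iff_seminorms:
  "(X \<longlongrightarrow> x) F \<longleftrightarrow> (\<forall>s. ((\<lambda>t. p s (X t - x)) \<longlongrightarrow> 0) F)"
proof safe
  fix s assume X: "(X \<longlongrightarrow> x) F"
  show "((\<lambda>t. p s (X t - x)) \<longlongrightarrow> 0) F"
  proof (rule tendstoI)
    fix \<epsilon> :: real assume "\<epsilon> > 0"
    define U where "U = {y. p s (y - x) < \<epsilon>}"
    have "open U" unfolding open_iff
    proof
      fix z assume z: "z \<in> U"
      have "p s (y - x) < \<epsilon>" if "p s (y - z) < \<epsilon> - p s (z - x)" for y
        using seminorm_triangle[OF seminorm, of s y x z] that by linarith
      then have "{y. \<forall>n\<in>{s}. p n (y - z) < \<epsilon> - p s (z - x)} \<subseteq> U"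
        unfolding U_def by blast
      moreover have "\<epsilon> - p s (z - x) > 0" using z by (simp add: U_def)
      ultimately show "\<exists>N \<epsilon>. finite N \<and> \<epsilon> > 0 \<and> {y. \<forall>n\<in>N. p n (y - z) < \<epsilon>} \<subseteq> U"
        by (meson finite.emptyI finite.insertI)
    qed
    moreover have "x \<in> U" using \<open>\<epsilon> > 0\<close> by (simp add: U_def seminorm_0[OF seminorm])
    ultimately have "\<forall>\<^sub>F t in F. X t \<in> U" by (rule topological_tendstoD[OF X])
    then show "\<forall>\<^sub>F t in F. dist (p s (X t - x)) 0 < \<epsilon>"
      by (simp add: U_def seminorm_nonneg[OF seminorm])
  qed
next
  assume X: "\<forall>s. ((\<lambda>t. p s (X t - x)) \<longlongrightarrow> 0) F"
  show "(X \<longlongrightarrow> x) F"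
  proof (rule topological_tendstoI)
    fix U assume "open U" "x \<in> U"
    then obtain N \<epsilon> where N: "finite N" "\<epsilon> > 0" "{y. \<forall>n\<in>N. p n (y - x) < \<epsilon>} \<subseteq> U"
      using open_iff[of U] by blast
    have "\<forall>\<^sub>F t in F. \<forall>n\<in>N. p n (X t - x) < \<epsilon>"
      using N(1,2) X by (intro eventually_ball_finite ballI order_tendstoD(2)[where y = 0]) auto
    then show "\<forall>\<^sub>F t in F. X t \<in> U" by eventually_elim (use N(3) in auto)
  qed
qed

text \<open>The sums of the first seminorms define the same topology and increase with the index, so
  that finitely many of them are dominated by a single one.\<close>

definition psum :: "nat \<Rightarrow> 'a \<Rightarrow> real" where
  "psum n x = (\<Sum>j\<le>n. p j x)"

lemma seminorm_psum: "seminorm (psum n)"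
  unfolding seminorm_def psum_def
  by (auto simp: seminorm_scaleR[OF seminorm] sum_distrib_left sum.distrib[symmetric]
      intro!: sum_mono seminorm_add[OF seminorm])

lemmas psum_simps = seminorm_0[OF seminorm_psum] seminorm_minus[OF seminorm_psum]
  seminorm_scaleR[OF seminorm_psum] seminorm_nonneg[OF seminorm_psum]

lemma le_psum: "p n x \<le> psum n x"
  unfolding psum_def by (rule member_le_sum) (auto simp: seminorm_nonneg[OF seminorm])

lemma psum_mono: "m \<le> n \<Longrightarrow> psum m x \<le> psum n x"
  unfolding psum_def by (rule sum_mono2) (auto simp: seminorm_nonneg[OF seminorm])

lemma tendsto_iff_psum:
  "(X \<longlongrightarrow> x) F \<longleftrightarrow> (\<forall>n. ((\<lambda>t. psum n (X t - x)) \<longlongrightarrow> 0) F)"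
proof
  assume "(X \<longlongrightarrow> x) F"
  then have "((\<lambda>t. \<Sum>j\<le>n. p j (X t - x)) \<longlongrightarrow> (\<Sum>j\<le>n. 0)) F" for n
    unfolding tendsto_iff_seminorms by (intro tendsto_sum) auto
  then show "\<forall>n. ((\<lambda>t. psum n (X t - x)) \<longlongrightarrow> 0) F" by (simp add: psum_def)
next
  assume *: "\<forall>n. ((\<lambda>t. psum n (X t - x)) \<longlongrightarrow> 0) F"
  show "(X \<longlongrightarrow> x) F" unfolding tendsto_iff_seminorms
  proof
    fix s show "((\<lambda>t. p s (X t - x)) \<longlongrightarrow> 0) F"
      by (rule tendsto_sandwich[of "\<lambda>_. 0" _ _ "\<lambda>t. psum s (X t - x)"])
        (use * in \<open>auto simp: seminorm_nonneg[OF seminorm] le_psum\<close>)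
  qed
qed

lemma tendstoI_psum:
  fixes X :: "'c \<Rightarrow> 'a"
  assumes "\<And>n \<epsilon>. \<epsilon> > 0 \<Longrightarrow> \<forall>\<^sub>F t in F. psum n (X t - x) < \<epsilon>"
  shows "(X \<longlongrightarrow> x) F"
  unfolding tendsto_iff_psum
proof
  fix n show "((\<lambda>t. psum n (X t - x)) \<longlongrightarrow> 0) F"
    by (rule tendstoI) (use assms in \<open>simp add: psum_simps\<close>)
qed

lemma tendstoD_psum:
  fixes X :: "'c \<Rightarrow> 'a"
  shows "(X \<longlongrightarrow> x) F \<Longrightarrow> \<epsilon> > 0 \<Longrightarrow> \<forall>\<^sub>F t in F. psum n (X t - x) < \<epsilon>"
  unfolding tendsto_iff_psum by (rule order_tendstoD(2)) auto

lemma tendsto_psum: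
  fixes X :: "'c \<Rightarrow> 'a"
  shows "(X \<longlongrightarrow> x) F \<Longrightarrow> ((\<lambda>t. psum n (X t)) \<longlongrightarrow> psum n x) F"
  by (rule Lim_null[THEN iffD2], rule Lim_null_comparison[of _ "\<lambda>t. psum n (X t - x)"])
    (simp_all add: tendsto_iff_psum seminorm_abs_diff[OF seminorm_psum])

lemma tendsto_add_frechet:
  fixes X Y :: "'c \<Rightarrow> 'a"
  assumes "(X \<longlongrightarrow> x) F" "(Y \<longlongrightarrow> y) F"
  shows "((\<lambda>t. X t + Y t) \<longlongrightarrow> x + y) F"
  unfolding tendsto_iff_psum
proof
  fix n
  show "((\<lambda>t. psum n (X t + Y t - (x + y))) \<longlongrightarrow> 0) F"
  proof (rule Lim_null_comparison[of _ "\<lambda>t. psum n (X t - x) + psum n (Y t - y)"])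
    show "((\<lambda>t. psum n (X t - x) + psum n (Y t - y)) \<longlongrightarrow> 0) F"
      using assms unfolding tendsto_iff_psum by (auto intro!: tendsto_add_zero)
    show "\<forall>\<^sub>F t in F. norm (psum n (X t + Y t - (x + y))) \<le> psum n (X t - x) + psum n (Y t - y)"
      using seminorm_add[OF seminorm_psum, of n "X t - x" "Y t - y" for t]
      by (intro always_eventually allI) (simp only: real_norm_def abs_of_nonneg psum_simps add_diff_add)
  qed
qed

lemma tendsto_scaleR_frechet:
  fixes X :: "'c \<Rightarrow> 'a"
  assumes "(X \<longlongrightarrow> x) F"
  shows "((\<lambda>t. c *\<^sub>R X t) \<longlongrightarrow> c *\<^sub>R x) F"
  using assms unfolding tendsto_iff_psum
  by (simp add: psum_simps tendsto_mult_right_zero flip: scaleR_right_diff_distrib)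

lemma tendsto_diff_frechet:
  fixes X Y :: "'c \<Rightarrow> 'a"
  shows "(X \<longlongrightarrow> x) F \<Longrightarrow> (Y \<longlongrightarrow> y) F \<Longrightarrow> ((\<lambda>t. X t - Y t) \<longlongrightarrow> x - y) F"
  using tendsto_add_frechet[of X x F "\<lambda>t. (-1) *\<^sub>R Y t" "(-1) *\<^sub>R y"] tendsto_scaleR_frechet[of Y y F "-1"]
  by simp

lemma tendsto_linear_combination:
  fixes \<alpha> :: "'i \<Rightarrow> 'c \<Rightarrow> real" and v :: "'i \<Rightarrow> 'a"
  assumes \<alpha>: "\<And>l. l \<in> G \<Longrightarrow> (\<alpha> l \<longlongrightarrow> \<beta> l) F"
  shows "((\<lambda>t. \<Sum>l\<in>G. \<alpha> l t *\<^sub>R v l) \<longlongrightarrow> (\<Sum>l\<in>G. \<beta> l *\<^sub>R v l)) F"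
  unfolding tendsto_iff_psum
proof
  fix n
  show "((\<lambda>t. psum n ((\<Sum>l\<in>G. \<alpha> l t *\<^sub>R v l) - (\<Sum>l\<in>G. \<beta> l *\<^sub>R v l))) \<longlongrightarrow> 0) F"
  proof (rule Lim_null_comparison[of _ "\<lambda>t. \<Sum>l\<in>G. \<bar>\<alpha> l t - \<beta> l\<bar> * psum n (v l)"])
    have "norm (psum n ((\<Sum>l\<in>G. \<alpha> l t *\<^sub>R v l) - (\<Sum>l\<in>G. \<beta> l *\<^sub>R v l)))
        \<le> (\<Sum>l\<in>G. \<bar>\<alpha> l t - \<beta> l\<bar> * psum n (v l))" for t
    proof -
      have "(\<Sum>l\<in>G. \<alpha> l t *\<^sub>R v l) - (\<Sum>l\<in>G. \<beta> l *\<^sub>R v l) = (\<Sum>l\<in>G. (\<alpha> l t - \<beta> l) *\<^sub>R v l)"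
        by (simp add: sum_subtractf scaleR_left_diff_distrib)
      then show ?thesis
        using seminorm_sum[OF seminorm_psum, of n "\<lambda>l. (\<alpha> l t - \<beta> l) *\<^sub>R v l" G]
        by (simp add: psum_simps)
    qed
    then show "\<forall>\<^sub>F t in F. norm (psum n ((\<Sum>l\<in>G. \<alpha> l t *\<^sub>R v l) - (\<Sum>l\<in>G. \<beta> l *\<^sub>R v l)))
        \<le> (\<Sum>l\<in>G. \<bar>\<alpha> l t - \<beta> l\<bar> * psum n (v l))" by simp
    have "((\<lambda>t. \<Sum>l\<in>G. \<bar>\<alpha> l t - \<beta> l\<bar> * psum n (v l)) \<longlongrightarrow> (\<Sum>l\<in>G. \<bar>\<beta> l - \<beta> l\<bar> * psum n (v l))) F"
      by (intro tendsto_intros \<alpha>)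
    then show "((\<lambda>t. \<Sum>l\<in>G. \<bar>\<alpha> l t - \<beta> l\<bar> * psum n (v l)) \<longlongrightarrow> 0) F" by simp
  qed
qed

lemma convergentI_psum:
  fixes X :: "nat \<Rightarrow> 'a"
  assumes "\<And>i \<epsilon>. \<epsilon> > 0 \<Longrightarrow> \<exists>N. \<forall>m\<ge>N. \<forall>n\<ge>N. psum i (X m - X n) < \<epsilon>"
  shows "\<exists>x. X \<longlonglongrightarrow> x"
proof -
  have "((\<lambda>(m, n). p s (X m - X n)) \<longlongrightarrow> 0) (sequentially \<times>\<^sub>F sequentially)" for s
  proof (rule tendstoI)
    fix \<epsilon> :: real assume "\<epsilon> > 0"
    then obtain N where N: "\<And>m n. m \<ge> N \<Longrightarrow> n \<ge> N \<Longrightarrow> psum s (X m - X n) < \<epsilon>"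
      using assms by blast
    show "\<forall>\<^sub>F z in sequentially \<times>\<^sub>F sequentially. dist (case z of (m, n) \<Rightarrow> p s (X m - X n)) 0 < \<epsilon>"
      unfolding eventually_prod_sequentially
      by (rule exI[of _ N]) (auto simp: seminorm_nonneg[OF seminorm] intro: le_less_trans[OF le_psum N])
  qed
  then have "convergent X" by (rule complete)
  then show ?thesis by (simp add: convergent_def)
qed

lemma Cauchy_psum:
  assumes "X \<longlonglongrightarrow> x" "\<epsilon> > 0"
  shows "\<exists>N. \<forall>m\<ge>N. \<forall>n\<ge>N. psum i (X m - X n) < \<epsilon>"
proof -
  from tendstoD_psum[OF assms(1), of "\<epsilon>/2" i] assms(2)
  obtain N where N: "\<And>n. n \<ge> N \<Longrightarrow> psum i (X n - x) < \<epsilon>/2"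
    by (auto simp: eventually_sequentially)
  have "psum i (X m - X n) < \<epsilon>" if "m \<ge> N" "n \<ge> N" for m n
    using N[OF that(1)] N[OF that(2)] seminorm_triangle[OF seminorm_psum, of i "X m" "X n" x]
      seminorm_diff_commute[OF seminorm_psum, of i "X n" x] by linarith
  then show ?thesis by blast
qed

end

section \<open>Unconditional Schauder bases\<close>

text \<open>Permuting inside each block separately moves an arbitrary subset of the block to its front.
  This turns badly behaved finite subsums of a series into consecutive partial sums of a
  rearrangement.\<close>

lemma bij_between_blocks_prescribed:
  fixes N :: "nat \<Rightarrow> nat"
  assumes N: "strict_mono N" "N 0 = 0" and F: "\<And>j. F j \<subseteq> {N j..<N (Suc j)}"
  obtains \<pi> where "bij \<pi>" "\<And>j. \<pi> ` {N j..<N j + card (F j)} = F j"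
proof -
  have "\<exists>g. bij_betw g {N j..<N (Suc j)} {N j..<N (Suc j)} \<and> g ` {N j..<N j + card (F j)} = F j" for j
  proof -
    let ?A = "{N j..<N (Suc j)}" and ?B = "{N j..<N j + card (F j)}"
    have fin: "finite (F j)" using F finite_subset by blast
    have card: "card (F j) \<le> N (Suc j) - N j" using card_mono[OF _ F[of j]] by simp
    have B: "?B \<subseteq> ?A" using card strict_mono_less[OF N(1), of j "Suc j"] by auto
    obtain g1 where g1: "bij_betw g1 ?B (F j)"
      using bij_betw_iff_card[of ?B "F j"] fin by auto
    obtain g2 where g2: "bij_betw g2 (?A - ?B) (?A - F j)"
      using bij_betw_iff_card[of "?A - ?B" "?A - F j"] fin F[of j] B
      by (auto simp: card_Diff_subset)
    define g where "g k = (if k \<in> ?B then g1 k else g2 k)" for k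
    have a: "bij_betw g ?B (F j)"
      using g1 by (rule iffD2[OF bij_betw_cong, rotated]) (simp add: g_def)
    have b: "bij_betw g (?A - ?B) (?A - F j)"
      using g2 by (rule iffD2[OF bij_betw_cong, rotated]) (simp add: g_def)
    have "bij_betw g (?B \<union> (?A - ?B)) (F j \<union> (?A - F j))"
      by (rule bij_betw_combine[OF a b]) auto
    moreover have "?B \<union> (?A - ?B) = ?A" "F j \<union> (?A - F j) = ?A" using B F[of j] by auto
    ultimately have "bij_betw g ?A ?A" by metis
    moreover have "g ` ?B = F j" using a by (simp add: bij_betw_def)
    ultimately show ?thesis by blast
  qed
  then obtain h where h: "\<And>j. bij_betw (h j) {N j..<N (Suc j)} {N j..<N (Suc j)}"
      "\<And>j. h j ` {N j..<N j + card (F j)} = F j"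
    by metis
  define idx where "idx k = (LEAST j. k < N (Suc j))" for k
  define \<pi> where "\<pi> k = h (idx k) k" for k
  have idx: "idx k = j" if "k \<in> {N j..<N (Suc j)}" for j k
    unfolding idx_def
  proof (rule Least_equality)
    fix i assume "k < N (Suc i)"
    then have "N j < N (Suc i)" using that by simp
    then show "j \<le> i" using N(1) by (simp add: strict_mono_less)
  qed (use that in simp)
  have UN: "(\<Union>j. {N j..<N (Suc j)}) = UNIV"
  proof -
    have "\<exists>j. k \<in> {N j..<N (Suc j)}" for k
    proof -
      have ex: "k < N (Suc k)"
        using strict_mono_imp_increasing[OF N(1), of "Suc k"] by simp
      have 1: "k < N (Suc (idx k))" unfolding idx_def by (rule LeastI[of _ k]) (rule ex)
      have "N (idx k) \<le> k"
      proof (cases "idx k")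
        case (Suc i)
        then have "\<not> k < N (Suc i)" unfolding idx_def by (metis lessI not_less_Least)
        then show ?thesis using Suc by simp
      qed (simp add: N)
      then show ?thesis using 1 by auto
    qed
    then show ?thesis by blast
  qed
  have bij: "bij_betw \<pi> {N j..<N (Suc j)} {N j..<N (Suc j)}" for j
    using h(1)[of j] by (rule iffD2[OF bij_betw_cong, rotated]) (simp add: \<pi>_def idx)
  have disj: "disjoint_family (\<lambda>j. {N j..<N (Suc j)})"
    unfolding disjoint_family_on_def
  proof (intro ballI impI)
    fix i j :: nat assume "i \<noteq> j"
    then show "{N i..<N (Suc i)} \<inter> {N j..<N (Suc j)} = {}" using idx[of _ i] idx[of _ j] by blast
  qed
  have "bij \<pi>" using bij_betw_UNION_disjoint[OF disj, of \<pi> "\<lambda>j. {N j..<N (Suc j)}"] bij UN by simp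
  moreover have "\<pi> ` {N j..<N j + card (F j)} = F j" for j
  proof -
    have "card (F j) \<le> N (Suc j) - N j" using card_mono[OF _ F[of j]] by simp
    moreover have "N j \<le> N (Suc j)" using N(1) by (simp add: strict_mono_less_eq)
    ultimately have "{N j..<N j + card (F j)} \<subseteq> {N j..<N (Suc j)}" by auto
    then have "\<pi> k = h j k" if "k \<in> {N j..<N j + card (F j)}" for k
      using that idx[of k j] by (auto simp: \<pi>_def)
    then show ?thesis using h(2)[of j] by (metis (no_types, lifting) image_cong)
  qed
  ultimately show thesis by (rule that)
qed

locale unconditional_frechet = frechet_space p
  for p :: "nat \<Rightarrow> 'a::{real_vector, t2_space} \<Rightarrow> real" +
  fixes e :: "nat \<Rightarrow> 'a"
  assumes unconditional: "unconditional_schauder_basis e"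
begin

section \<open>Coordinates\<close>

lemma coord_sums: "(\<lambda>k. coord e x k *\<^sub>R e k) sums x"
proof -
  have "\<exists>!c. (\<lambda>k. c k *\<^sub>R e k) sums x"
    using unconditional by (simp add: unconditional_schauder_basis_def schauder_basis_def)
  then show ?thesis unfolding coord_def by (rule theI')
qed

lemma coord_eqI:
  assumes "(\<lambda>k. c k *\<^sub>R e k) sums x"
  shows "coord e x = c"
proof -
  have "\<exists>!c. (\<lambda>k. c k *\<^sub>R e k) sums x"
    using unconditional by (simp add: unconditional_schauder_basis_def schauder_basis_def)
  then show ?thesis using coord_sums[of x] assms by blast
qed

lemma partial_sums_tendsto: "(\<lambda>n. \<Sum>k<n. coord e x k *\<^sub>R e k) \<longlonglongrightarrow> x"
  using coord_sums by (simp add: sums_def)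

lemma ext_coord: "(\<And>k. coord e x k = coord e y k) \<Longrightarrow> x = y"
  using coord_sums[of x] coord_sums[of y] by (simp add: sums_unique2)

lemma coord_add [simp]: "coord e (x + y) k = coord e x k + coord e y k"
proof -
  have "(\<lambda>k. (coord e x k + coord e y k) *\<^sub>R e k) sums (x + y)"
    using tendsto_add_frechet[OF partial_sums_tendsto partial_sums_tendsto, of x y]
    by (simp add: sums_def scaleR_left_distrib sum.distrib)
  then show ?thesis by (simp add: coord_eqI)
qed

lemma coord_scaleR [simp]: "coord e (c *\<^sub>R x) k = c * coord e x k"
proof -
  have "(\<lambda>k. (c * coord e x k) *\<^sub>R e k) sums (c *\<^sub>R x)"
    using tendsto_scaleR_frechet[OF partial_sums_tendsto, of c x]
    by (simp add: sums_def scaleR_sum_right)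
  then show ?thesis by (simp add: coord_eqI)
qed

lemma coord_0 [simp]: "coord e 0 k = 0"
  using coord_scaleR[of 0 0 k] by simp

lemma coord_diff [simp]: "coord e (x - y) k = coord e x k - coord e y k"
  using coord_add[of "x - y" y k] by simp

lemma coord_sum [simp]: "coord e (\<Sum>i\<in>I. x i) k = (\<Sum>i\<in>I. coord e (x i) k)"
  by (induction I rule: infinite_finite_induct) auto

lemma coord_finite_combination:
  "finite F \<Longrightarrow> coord e (\<Sum>k\<in>F. c k *\<^sub>R e k) = (\<lambda>k. if k \<in> F then c k else 0)"
proof (rule coord_eqI)
  assume "finite F"
  then have "(\<lambda>k. if k \<in> F then c k *\<^sub>R e k else 0) sums (\<Sum>k\<in>F. c k *\<^sub>R e k)"
    by (rule sums_If_finite_set)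
  moreover have "(\<lambda>k. if k \<in> F then c k *\<^sub>R e k else 0) = (\<lambda>k. (if k \<in> F then c k else 0) *\<^sub>R e k)"
    by auto
  ultimately show "(\<lambda>k. (if k \<in> F then c k else 0) *\<^sub>R e k) sums (\<Sum>k\<in>F. c k *\<^sub>R e k)" by simp
qed

text \<open>A basis vector is nonzero because the expansion of \<open>0\<close> is unique, and the seminorms separate
  points.\<close>

lemma basis_psum_pos: "\<exists>i. psum i (e k) > 0"
proof (rule ccontr)
  assume *: "\<nexists>i. psum i (e k) > 0"
  have "psum i (e k) = 0" for i
    using * seminorm_nonneg[OF seminorm_psum, of i "e k"] by (metis less_eq_real_def)
  then have "((\<lambda>_. e k) \<longlongrightarrow> 0) sequentially" by (simp add: tendsto_iff_psum)
  then have "e k = 0" by (simp add: LIMSEQ_const_iff)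
  then have "coord e (\<Sum>k\<in>{k}. 1 *\<^sub>R e k) k = 0" by simp
  then show False by (subst (asm) coord_finite_combination) auto
qed

section \<open>Unconditional convergence controls all finite subsums\<close>

text \<open>Were the tails not small, there would be finite sets \<open>F\<^sub>0 < F\<^sub>1 < \<dots>\<close> whose subsums stay away
  from zero; the rearrangement that lists each of them consecutively would not be Cauchy.\<close>

lemma unconditional_tail:
  assumes "\<epsilon> > 0"
  shows "\<exists>N. \<forall>F. finite F \<and> F \<subseteq> {N..} \<longrightarrow> psum s (\<Sum>k\<in>F. coord e x k *\<^sub>R e k) < \<epsilon>"
proof (rule ccontr)
  let ?v = "\<lambda>k. coord e x k *\<^sub>R e k"
  assume "\<not> ?thesis"
  then have "\<forall>N. \<exists>F. finite F \<and> F \<subseteq> {N..} \<and> \<epsilon> \<le> psum s (\<Sum>k\<in>F. ?v k)" by (simp add: not_less)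
  then obtain G where G: "\<And>N. finite (G N)" "\<And>N. G N \<subseteq> {N..}" "\<And>N. \<epsilon> \<le> psum s (\<Sum>k\<in>G N. ?v k)"
    by metis
  define N where "N = rec_nat 0 (\<lambda>_ n. Suc (Max (insert n (G n))))"
  have N0: "N 0 = 0" and NS: "N (Suc j) = Suc (Max (insert (N j) (G (N j))))" for j
    by (simp_all add: N_def)
  have mono: "strict_mono N"
    unfolding strict_mono_Suc_iff NS using G(1) by (auto intro!: le_imp_less_Suc Max_ge)
  have "G (N j) \<subseteq> {N j..<N (Suc j)}" for j
    using G(1,2)[of "N j"] by (auto simp: NS intro!: le_imp_less_Suc Max_ge)
  from bij_between_blocks_prescribed[OF mono N0, of "\<lambda>j. G (N j)", OF this]
  obtain \<pi> where \<pi>: "bij \<pi>" "\<And>j. \<pi> ` {N j..<N j + card (G (N j))} = G (N j)" by blast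
  have "(\<lambda>k. ?v (\<pi> k)) sums x"
    using unconditional \<pi>(1) by (simp add: unconditional_schauder_basis_def)
  then have "(\<lambda>n. \<Sum>k<n. ?v (\<pi> k)) \<longlonglongrightarrow> x" by (simp add: sums_def)
  from Cauchy_psum[OF this assms, of s] obtain K where
    K: "\<And>m n. m \<ge> K \<Longrightarrow> n \<ge> K \<Longrightarrow> psum s ((\<Sum>k<m. ?v (\<pi> k)) - (\<Sum>k<n. ?v (\<pi> k))) < \<epsilon>" by blast
  let ?n = "N K" and ?m = "N K + card (G (N K))"
  have ge: "K \<le> ?n" using strict_mono_imp_increasing[OF mono] .
  have inj: "inj_on \<pi> {?n..<?m}" using bij_is_inj[OF \<pi>(1)] by (rule inj_on_subset) simp
  have "(\<Sum>k<?m. ?v (\<pi> k)) - (\<Sum>k<?n. ?v (\<pi> k)) = (\<Sum>k\<in>{?n..<?m}. ?v (\<pi> k))"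
    unfolding lessThan_atLeast0 by (rule sum_diff_nat_ivl) auto
  also have "\<dots> = (\<Sum>k\<in>\<pi> ` {?n..<?m}. ?v k)"
    by (subst sum.reindex[OF inj]) simp
  also have "\<dots> = (\<Sum>k\<in>G (N K). ?v k)" unfolding \<pi>(2) ..
  finally have "psum s (\<Sum>k\<in>G (N K). ?v k) < \<epsilon>" using K[of ?m ?n] ge by simp
  then show False using G(3)[of "N K"] by simp
qed

lemma finite_subsums_bounded:
  "\<exists>B. \<forall>F. finite F \<longrightarrow> psum s (\<Sum>k\<in>F. coord e x k *\<^sub>R e k) \<le> B"
proof -
  let ?v = "\<lambda>k. coord e x k *\<^sub>R e k"
  obtain N where N: "\<And>F. finite F \<Longrightarrow> F \<subseteq> {N..} \<Longrightarrow> psum s (\<Sum>k\<in>F. ?v k) < 1"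
    using unconditional_tail[of 1 s x] by auto
  have "psum s (\<Sum>k\<in>F. ?v k) \<le> (\<Sum>k<N. psum s (?v k)) + 1" if F: "finite F" for F
  proof -
    have "(\<Sum>k\<in>F. ?v k) = (\<Sum>k\<in>F \<inter> {..<N}. ?v k) + (\<Sum>k\<in>F \<inter> {N..}. ?v k)"
      by (subst sum.union_disjoint[symmetric]) (use F in \<open>auto intro!: sum.cong\<close>)
    then have "psum s (\<Sum>k\<in>F. ?v k) \<le> psum s (\<Sum>k\<in>F \<inter> {..<N}. ?v k) + psum s (\<Sum>k\<in>F \<inter> {N..}. ?v k)"
      using seminorm_add[OF seminorm_psum] by simp
    moreover have "psum s (\<Sum>k\<in>F \<inter> {..<N}. ?v k) \<le> (\<Sum>k<N. psum s (?v k))"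
      by (rule order_trans[OF seminorm_sum[OF seminorm_psum]])
        (rule sum_mono2, auto intro: seminorm_nonneg[OF seminorm_psum])
    moreover have "psum s (\<Sum>k\<in>F \<inter> {N..}. ?v k) < 1" using F by (intro N) auto
    ultimately show ?thesis by linarith
  qed
  then show ?thesis by blast
qed

text \<open>The unconditional seminorm. With respect to it coordinates are bounded by construction
  (\<open>coord_psum_le_usem\<close>) and it is monotone under domination of coordinates up to a factor
  (\<open>usem_dominated\<close>).\<close>

definition usem :: "nat \<Rightarrow> 'a \<Rightarrow> real" where
  "usem n x = (SUP F\<in>{F. finite F}. psum n (\<Sum>k\<in>F. coord e x k *\<^sub>R e k))"

lemma finite_subsum_le_usem:
  assumes "finite F"
  shows "psum n (\<Sum>k\<in>F. coord e x k *\<^sub>R e k) \<le> usem n x"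
proof -
  obtain B where "\<And>F. finite F \<Longrightarrow> psum n (\<Sum>k\<in>F. coord e x k *\<^sub>R e k) \<le> B"
    using finite_subsums_bounded[of n x] by blast
  then have "bdd_above ((\<lambda>F. psum n (\<Sum>k\<in>F. coord e x k *\<^sub>R e k)) ` {F. finite F})"
    by (intro bdd_aboveI2[of _ _ B]) auto
  then show ?thesis unfolding usem_def by (intro cSUP_upper) (use assms in auto)
qed

lemma usem_leI:
  "(\<And>F. finite F \<Longrightarrow> psum n (\<Sum>k\<in>F. coord e x k *\<^sub>R e k) \<le> B) \<Longrightarrow> usem n x \<le> B"
  unfolding usem_def by (intro cSUP_least) auto

lemma psum_le_usem: "psum n x \<le> usem n x"
proof (rule LIMSEQ_le_const2[OF tendsto_psum[OF partial_sums_tendsto]])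
  show "\<exists>N. \<forall>m\<ge>N. psum n (\<Sum>k<m. coord e x k *\<^sub>R e k) \<le> usem n x"
    by (intro exI[of _ 0] allI impI finite_subsum_le_usem) auto
qed

lemma usem_add: "usem n (x + y) \<le> usem n x + usem n y"
proof (rule usem_leI)
  fix F :: "nat set" assume F: "finite F"
  have "(\<Sum>k\<in>F. coord e (x + y) k *\<^sub>R e k)
      = (\<Sum>k\<in>F. coord e x k *\<^sub>R e k) + (\<Sum>k\<in>F. coord e y k *\<^sub>R e k)"
    by (simp add: scaleR_left_distrib sum.distrib)
  then show "psum n (\<Sum>k\<in>F. coord e (x + y) k *\<^sub>R e k) \<le> usem n x + usem n y"
    using order_trans[OF seminorm_add[OF seminorm_psum]
        add_mono[OF finite_subsum_le_usem[OF F, of n x] finite_subsum_le_usem[OF F, of n y]]]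
    by simp
qed

lemma usem_scaleR: "usem n (c *\<^sub>R x) \<le> \<bar>c\<bar> * usem n x"
proof (rule usem_leI)
  fix F :: "nat set" assume F: "finite F"
  have "(\<Sum>k\<in>F. coord e (c *\<^sub>R x) k *\<^sub>R e k) = c *\<^sub>R (\<Sum>k\<in>F. coord e x k *\<^sub>R e k)"
    by (simp add: scaleR_sum_right)
  then show "psum n (\<Sum>k\<in>F. coord e (c *\<^sub>R x) k *\<^sub>R e k) \<le> \<bar>c\<bar> * usem n x"
    by (simp add: psum_simps finite_subsum_le_usem[OF F] mult_left_mono del: coord_scaleR)
qed

lemma usem_diff: "usem n (x - y) \<le> usem n x + usem n y"
  using usem_add[of n x "(-1) *\<^sub>R y"] usem_scaleR[of n "-1" y] by simp

lemma usem_mono: "m \<le> n \<Longrightarrow> usem m x \<le> usem n x"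
  by (rule usem_leI) (rule order_trans[OF psum_mono finite_subsum_le_usem])

lemma usem_dominated:
  assumes "\<And>k. \<bar>coord e y k\<bar> \<le> \<bar>coord e x k\<bar>"
  shows "usem n y \<le> 2 * usem n x"
proof (rule usem_leI)
  fix F :: "nat set" assume F: "finite F"
  show "psum n (\<Sum>k\<in>F. coord e y k *\<^sub>R e k) \<le> 2 * usem n x"
    by (rule seminorm_dominated_sum_le[OF seminorm_psum F assms])
      (rule finite_subsum_le_usem, rule finite_subset[OF _ F])
qed

lemma coord_psum_le_usem: "\<bar>coord e x k\<bar> * psum n (e k) \<le> usem n x"
  using finite_subsum_le_usem[of "{k}" n x] by (simp add: psum_simps)

section \<open>The open mapping argument\<close>

text \<open>Membership in the closure, with respect to the original topology, of the ball
  \<open>{v. usem i v \<le> r}\<close>.\<close>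

definition in_closed_uball :: "nat \<Rightarrow> real \<Rightarrow> 'a \<Rightarrow> bool" where
  "in_closed_uball i r x \<longleftrightarrow> (\<forall>j \<eta>. \<eta> > 0 \<longrightarrow> (\<exists>v. usem i v \<le> r \<and> psum j (x - v) < \<eta>))"

lemma in_closed_uball_mono: "in_closed_uball i r x \<Longrightarrow> r \<le> s \<Longrightarrow> in_closed_uball i s x"
  unfolding in_closed_uball_def by (meson order_trans)

lemma in_closed_uball_diff:
  assumes "in_closed_uball i r x" "in_closed_uball i s y"
  shows "in_closed_uball i (r + s) (x - y)"
  unfolding in_closed_uball_def
proof (intro allI impI)
  fix j and \<eta> :: real assume "\<eta> > 0"
  then have "\<eta>/2 > 0" by simp
  then obtain u v where u: "usem i u \<le> r" "psum j (x - u) < \<eta>/2"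
      and v: "usem i v \<le> s" "psum j (y - v) < \<eta>/2"
    using assms unfolding in_closed_uball_def by meson
  have "usem i (u - v) \<le> r + s" using usem_diff[of i u v] u v by linarith
  moreover have "psum j ((x - y) - (u - v)) < \<eta>"
    using seminorm_diff[OF seminorm_psum, of j "x - u" "y - v"] u v by (simp add: algebra_simps)
  ultimately show "\<exists>w. usem i w \<le> r + s \<and> psum j ((x - y) - w) < \<eta>" by blast
qed

lemma in_closed_uball_scaleR:
  assumes "in_closed_uball i r x" "c > 0"
  shows "in_closed_uball i (c * r) (c *\<^sub>R x)"
  unfolding in_closed_uball_def
proof (intro allI impI)
  fix j and \<eta> :: real assume "\<eta> > 0"
  then have "\<eta>/c > 0" using assms by simp
  then obtain v where v: "usem i v \<le> r" "psum j (x - v) < \<eta>/c"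
    using assms unfolding in_closed_uball_def by meson
  have "usem i (c *\<^sub>R v) \<le> c * usem i v" using usem_scaleR[of i c v] assms(2) by simp
  also have "\<dots> \<le> c * r" using v(1) assms(2) by simp
  finally have "usem i (c *\<^sub>R v) \<le> c * r" .
  moreover have "psum j (c *\<^sub>R x - c *\<^sub>R v) < \<eta>"
    using v(2) assms(2) by (simp add: psum_simps pos_less_divide_eq mult.commute flip: scaleR_right_diff_distrib)
  ultimately show "\<exists>w. usem i w \<le> c * r \<and> psum j (c *\<^sub>R x - w) < \<eta>" by blast
qed

text \<open>Baire's theorem for the cover of the space by the closures of the balls \<open>{v. usem i v \<le> r}\<close>,
  \<open>r \<in> \<nat>\<close>, carried out directly with the seminorms. If no closure had an interior point, nested
  seminorm balls could be chosen such that the \<open>n\<close>-th step avoids the ball of radius \<open>n\<close>; their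
  centres converge to a point \<open>z\<close> with \<open>usem i z\<close> larger than every \<open>n\<close>.\<close>

lemma ball_in_some_closed_uball:
  "\<exists>r x m \<delta>. \<delta> > 0 \<and> (\<forall>y. psum m (y - x) < \<delta> \<longrightarrow> in_closed_uball i (real r) y)"
proof (rule ccontr)
  assume neg: "\<not> ?thesis"
  \<comment> \<open>A state \<open>(x, m, \<delta>)\<close> stands for the closed ball \<open>{w. psum m (w - x) \<le> \<delta>}\<close>.\<close>
  define P :: "nat \<Rightarrow> 'a \<times> nat \<times> real \<Rightarrow> bool" where "P n s \<longleftrightarrow> snd (snd s) > 0" for n s
  define R :: "nat \<Rightarrow> 'a \<times> nat \<times> real \<Rightarrow> 'a \<times> nat \<times> real \<Rightarrow> bool" where
    "R n s s' \<longleftrightarrow> (case (s, s') of ((x, m, \<delta>), (x', m', \<delta>')) \<Rightarrow>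
       (\<forall>w. psum m' (w - x') \<le> \<delta>' \<longrightarrow> psum m (w - x) \<le> \<delta>) \<and>
       (\<forall>v. usem i v \<le> real n \<longrightarrow> \<delta>' < psum m' (v - x')) \<and> n \<le> m' \<and> \<delta>' \<le> 1 / real (Suc n))" for n s s'
  have "\<exists>s. \<forall>n. P n (s n) \<and> R n (s n) (s (Suc n))"
  proof (rule dependent_nat_choice)
    show "\<exists>s. P 0 s" unfolding P_def by (rule exI[of _ "(0, 0, 1)"]) simp
  next
    fix s n assume "P n s"
    obtain x m \<delta> where s: "s = (x, m, \<delta>)" by (cases s)
    have \<delta>: "\<delta> > 0" using \<open>P n s\<close> by (simp add: P_def s)
    then obtain y where y: "psum m (y - x) < \<delta>" "\<not> in_closed_uball i (real n) y"
      using neg by blast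
    then obtain j \<eta> where \<eta>: "\<eta> > 0" "\<And>v. usem i v \<le> real n \<Longrightarrow> \<eta> \<le> psum j (y - v)"
      unfolding in_closed_uball_def by (auto simp: not_less)
    define m' where "m' = max j (max n m)"
    define \<delta>' where "\<delta>' = min (\<eta>/2) (min (\<delta> - psum m (y - x)) (1 / real (Suc n)))"
    have pos: "\<delta>' > 0" using \<eta>(1) y(1) by (simp add: \<delta>'_def)
    have le: "\<delta>' \<le> \<eta>/2" "\<delta>' \<le> \<delta> - psum m (y - x)" "\<delta>' \<le> 1 / real (Suc n)"
      unfolding \<delta>'_def
      by (rule min.cobounded1, rule min.coboundedI2, rule min.cobounded1, rule min.coboundedI2, rule min.cobounded2)
    have a: "psum m (w - x) \<le> \<delta>" if "psum m' (w - y) \<le> \<delta>'" for w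
    proof -
      have "psum m (w - y) \<le> psum m' (w - y)" by (rule psum_mono) (simp add: m'_def)
      then have "psum m (w - y) \<le> \<delta>'" using that by linarith
      then show ?thesis using seminorm_triangle[OF seminorm_psum, of m w x y] le(2) y(1) by linarith
    qed
    have b: "\<delta>' < psum m' (v - y)" if "usem i v \<le> real n" for v
    proof -
      have "\<eta> \<le> psum j (y - v)" using \<eta>(2) that .
      also have "\<dots> \<le> psum m' (y - v)" by (rule psum_mono) (simp add: m'_def)
      also have "\<dots> = psum m' (v - y)" by (rule seminorm_diff_commute[OF seminorm_psum])
      finally show ?thesis using le(1) \<eta>(1) by linarith
    qed
    have "n \<le> m'" by (simp add: m'_def)
    then show "\<exists>s'. P (Suc n) s' \<and> R n s s'"
      unfolding P_def R_def s
      by (intro exI[of _ "(y, m', \<delta>')"]) (use pos a b le(3) in simp)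
  qed
  then obtain s where s: "\<And>n. P n (s n)" "\<And>n. R n (s n) (s (Suc n))" by blast
  define x m \<delta> where "x n = fst (s n)" and "m n = fst (snd (s n))" and "\<delta> n = snd (snd (s n))" for n
  have sn: "s n = (x n, m n, \<delta> n)" for n by (simp add: x_def m_def \<delta>_def)
  have pos: "\<delta> n > 0" for n using s(1)[of n] by (simp add: P_def \<delta>_def)
  have nest: "psum (m n) (w - x n) \<le> \<delta> n" if "psum (m (Suc n)) (w - x (Suc n)) \<le> \<delta> (Suc n)" for n w
    using s(2)[of n] that by (simp add: R_def sn)
  \<comment> \<open>The ball with number \<open>Suc n\<close> contains no point of the unconditional ball of radius \<open>n\<close>.\<close>
  have avoid: "\<delta> (Suc n) < psum (m (Suc n)) (v - x (Suc n))" if "usem i v \<le> real n" for n v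
    using s(2)[of n] that by (simp add: R_def sn)
  have m: "n \<le> m (Suc n)" and \<delta>: "\<delta> (Suc n) \<le> 1 / real (Suc n)" for n
    using s(2)[of n] by (simp_all add: R_def sn)
  have nests: "psum (m n) (w - x n) \<le> \<delta> n" if "psum (m (n + k)) (w - x (n + k)) \<le> \<delta> (n + k)" for n k w
    using that
  proof (induction k)
    case (Suc k)
    show ?case by (rule Suc.IH, rule nest) (use Suc.prems in simp)
  qed simp
  have ball: "psum (m n) (x l - x n) \<le> \<delta> n" if "n \<le> l" for n l
    using nests[of n "l - n" "x l"] that pos[of l] by (simp add: psum_simps)
  have "\<exists>N. \<forall>k\<ge>N. \<forall>l\<ge>N. psum h (x k - x l) < \<epsilon>" if "\<epsilon> > 0" for h \<epsilon>
  proof -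
    obtain n0 :: nat where n0: "2 / \<epsilon> < real n0" using reals_Archimedean2 by blast
    define n where "n = max n0 h"
    have "2 / \<epsilon> < real (Suc n)" using n0 by (simp add: n_def)
    then have small: "2 * (1 / real (Suc n)) < \<epsilon>" using \<open>\<epsilon> > 0\<close> by (simp add: field_simps)
    have "psum h (x k - x l) < \<epsilon>" if "k \<ge> Suc n" "l \<ge> Suc n" for k l
    proof -
      have "psum h (x k - x l) \<le> psum (m (Suc n)) (x k - x l)"
        by (rule psum_mono, rule order_trans[OF _ m]) (simp add: n_def)
      also have "\<dots> \<le> psum (m (Suc n)) (x k - x (Suc n)) + psum (m (Suc n)) (x l - x (Suc n))"
        using seminorm_diff[OF seminorm_psum, of "m (Suc n)" "x k - x (Suc n)" "x l - x (Suc n)"] by simp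
      also have "\<dots> \<le> 2 * (1 / real (Suc n))"
        using ball[OF that(1)] ball[OF that(2)] \<delta>[of n] by linarith
      finally show ?thesis using small by linarith
    qed
    then show ?thesis by blast
  qed
  from convergentI_psum[of x, OF this] obtain z where z: "x \<longlonglongrightarrow> z" by blast
  have z_ball: "psum (m n) (z - x n) \<le> \<delta> n" for n
  proof (rule LIMSEQ_le_const2)
    show "(\<lambda>l. psum (m n) (x l - x n)) \<longlonglongrightarrow> psum (m n) (z - x n)"
      by (intro tendsto_psum tendsto_diff_frechet z tendsto_const)
    show "\<exists>N. \<forall>l\<ge>N. psum (m n) (x l - x n) \<le> \<delta> n" using ball by blast
  qed
  obtain n :: nat where "usem i z \<le> real n" using real_arch_simple by blast
  then show False using avoid[of z n] z_ball[of "Suc n"] by linarith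
qed

text \<open>An interior point \<open>x\<close> of the closure is moved to the origin by subtracting \<open>x\<close>, which doubles
  the radius \<open>r\<close>; scaling by \<open>2 r + 1\<close> brings it below 1.\<close>

lemma zero_neighbourhood_in_closed_uball:
  "\<exists>m \<delta>. \<delta> > 0 \<and> (\<forall>x. psum m x < \<delta> \<longrightarrow> in_closed_uball i 1 x)"
proof -
  obtain r :: nat and x m \<delta> where \<delta>: "\<delta> > 0"
    and ball: "\<And>y. psum m (y - x) < \<delta> \<Longrightarrow> in_closed_uball i (real r) y"
    using ball_in_some_closed_uball by blast
  define c where "c = 2 * real r + 1"
  have c: "c > 0" by (simp add: c_def)
  have "in_closed_uball i 1 z" if z: "psum m z < \<delta> / c" for z
  proof -
    have "psum m (c *\<^sub>R z) < \<delta>" using z c by (simp add: psum_simps field_simps)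
    then have "in_closed_uball i (real r) (x + c *\<^sub>R z)" by (intro ball) simp
    moreover have "in_closed_uball i (real r) x" using \<delta> by (intro ball) (simp add: psum_simps)
    ultimately have "in_closed_uball i (real r + real r) (x + c *\<^sub>R z - x)"
      by (rule in_closed_uball_diff)
    then have "in_closed_uball i (2 * real r) (c *\<^sub>R z)" by simp
    from in_closed_uball_scaleR[OF this, of "1 / c"] c
    have "in_closed_uball i (2 * real r / c) z" by simp
    then show ?thesis by (rule in_closed_uball_mono) (simp add: c_def)
  qed
  then show ?thesis using \<delta> c by (intro exI[of _ m] exI[of _ "\<delta> / c"]) auto
qed

lemma geometric_block_sum: "K \<le> L \<Longrightarrow> (\<Sum>k\<in>{K..<L}. (1/2) ^ k) \<le> 2 * (1/2::real) ^ K"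
proof -
  assume "K \<le> L"
  then have "(\<Sum>k\<in>{K..<L}. (1/2) ^ k) = 2 * (1/2::real) ^ K - 2 * (1/2) ^ L"
    by (induction L rule: dec_induct) (simp_all add: sum.atLeastLessThan_Suc)
  then show ?thesis by simp
qed

text \<open>Completeness with respect to the seminorms \<open>usem\<close>: a series that is summable for them
  converges for them as well, and to the same sum. Continuity of the coordinates is not known
  yet, so the coordinates of the sum cannot be read off from \<open>x\<close>; they are defined as the sums
  \<open>c\<close> of the coordinates of the terms, and \<open>c\<close> is shown to expand \<open>x\<close>.\<close>

lemma usem_series:
  assumes v: "\<And>k. usem (n + k) (v k) \<le> (1/2) ^ k"
    and x: "(\<lambda>K. \<Sum>k<K. v k) \<longlonglongrightarrow> x"
  shows "usem n x \<le> 2"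
proof -
  define a where "a k l = coord e (v k) l" for k l
  have usem_v: "usem i (v k) \<le> (1/2) ^ k" if "i \<le> n + k" for i k
    using usem_mono[OF that] v order_trans by blast
  have summ: "summable (\<lambda>k. a k l)" for l
  proof -
    obtain i where i: "psum i (e l) > 0" using basis_psum_pos by blast
    have "summable (\<lambda>k. (1/2) ^ k / psum i (e l))" by (intro summable_divide summable_geometric) simp
    moreover have "norm (a k l) \<le> (1/2) ^ k / psum i (e l)" if "k \<ge> i" for k
      using coord_psum_le_usem[of "v k" l i] usem_v[of i k] that i
      by (simp add: a_def pos_le_divide_eq)
    ultimately show ?thesis by (rule summable_comparison_test')
  qed
  define c where "c l = (\<Sum>k. a k l)" for l
  \<comment> \<open>The partial sums of the series approximate \<open>c\<close> uniformly over all finite sets of coordinates.\<close>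
  have tail: "psum i (\<Sum>l\<in>F. (c l - (\<Sum>k<K. a k l)) *\<^sub>R e l) \<le> 2 * (1/2) ^ K"
    if F: "finite F" and i: "i \<le> n + K" for i K F
  proof (rule LIMSEQ_le_const2)
    have "(\<lambda>L. (\<Sum>k<L. a k l) - (\<Sum>k<K. a k l)) \<longlonglongrightarrow> c l - (\<Sum>k<K. a k l)" for l
      unfolding c_def by (intro tendsto_diff summable_LIMSEQ summ tendsto_const)
    then show "(\<lambda>L. psum i (\<Sum>l\<in>F. ((\<Sum>k<L. a k l) - (\<Sum>k<K. a k l)) *\<^sub>R e l))
        \<longlonglongrightarrow> psum i (\<Sum>l\<in>F. (c l - (\<Sum>k<K. a k l)) *\<^sub>R e l)"
      by (intro tendsto_psum tendsto_linear_combination)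
    have "psum i (\<Sum>l\<in>F. ((\<Sum>k<L. a k l) - (\<Sum>k<K. a k l)) *\<^sub>R e l) \<le> 2 * (1/2) ^ K" if "L \<ge> K" for L
    proof -
      have "(\<Sum>k<L. a k l) - (\<Sum>k<K. a k l) = (\<Sum>k\<in>{K..<L}. a k l)" for l
        unfolding lessThan_atLeast0 by (rule sum_diff_nat_ivl) (use that in auto)
      then have "(\<Sum>l\<in>F. ((\<Sum>k<L. a k l) - (\<Sum>k<K. a k l)) *\<^sub>R e l)
          = (\<Sum>k\<in>{K..<L}. \<Sum>l\<in>F. a k l *\<^sub>R e l)"
        by (simp add: scaleR_sum_left sum.swap[of _ F])
      then have "psum i (\<Sum>l\<in>F. ((\<Sum>k<L. a k l) - (\<Sum>k<K. a k l)) *\<^sub>R e l)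
          \<le> (\<Sum>k\<in>{K..<L}. psum i (\<Sum>l\<in>F. a k l *\<^sub>R e l))"
        by (simp add: seminorm_sum[OF seminorm_psum])
      also have "\<dots> \<le> (\<Sum>k\<in>{K..<L}. (1/2) ^ k)"
      proof (rule sum_mono)
        fix k assume "k \<in> {K..<L}"
        then have "usem i (v k) \<le> (1/2) ^ k" using i by (intro usem_v) simp
        then show "psum i (\<Sum>l\<in>F. a k l *\<^sub>R e l) \<le> (1/2) ^ k"
          unfolding a_def using finite_subsum_le_usem[OF F, of i "v k"] by linarith
      qed
      also have "\<dots> \<le> 2 * (1/2) ^ K" using geometric_block_sum[OF that] .
      finally show ?thesis .
    qed
    then show "\<exists>N. \<forall>L\<ge>N. psum i (\<Sum>l\<in>F. ((\<Sum>k<L. a k l) - (\<Sum>k<K. a k l)) *\<^sub>R e l) \<le> 2 * (1/2) ^ K"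
      by blast
  qed
  have "(\<lambda>l. c l *\<^sub>R e l) sums x"
    unfolding sums_def
  proof (rule tendstoI_psum)
    fix i and \<epsilon> :: real assume \<epsilon>: "\<epsilon> > 0"
    then have \<epsilon>3: "\<epsilon>/3 > 0" by simp
    have "(\<lambda>K. 2 * (1/2::real) ^ K) \<longlonglongrightarrow> 0"
      by (intro tendsto_mult_right_zero LIMSEQ_realpow_zero) auto
    then have "\<forall>\<^sub>F K in sequentially. 2 * (1/2::real) ^ K < \<epsilon>/3" using \<epsilon>3 by (rule order_tendstoD(2))
    moreover have "\<forall>\<^sub>F K in sequentially. psum i ((\<Sum>k<K. v k) - x) < \<epsilon>/3"
      using tendstoD_psum[OF x \<epsilon>3] .
    moreover have "\<forall>\<^sub>F K in sequentially. i \<le> K" by (rule eventually_ge_at_top)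
    ultimately have "\<forall>\<^sub>F K in sequentially. i \<le> K \<and> 2 * (1/2::real) ^ K < \<epsilon>/3
        \<and> psum i ((\<Sum>k<K. v k) - x) < \<epsilon>/3" by eventually_elim auto
    then obtain K where K: "i \<le> K" "2 * (1/2::real) ^ K < \<epsilon>/3" "psum i ((\<Sum>k<K. v k) - x) < \<epsilon>/3"
      unfolding eventually_sequentially by blast
    define s where "s = (\<Sum>k<K. v k)"
    have cs: "coord e s l = (\<Sum>k<K. a k l)" for l by (simp add: s_def a_def)
    have "\<forall>\<^sub>F L in sequentially. psum i ((\<Sum>l<L. coord e s l *\<^sub>R e l) - s) < \<epsilon>/3"
      using tendstoD_psum[OF partial_sums_tendsto \<epsilon>3] .
    then show "\<forall>\<^sub>F L in sequentially. psum i ((\<Sum>l<L. c l *\<^sub>R e l) - x) < \<epsilon>"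
    proof eventually_elim
      case (elim L)
      \<comment> \<open>The three parts are: \<open>c\<close> against the coordinates of \<open>s\<close>, the expansion of \<open>s\<close>, and \<open>s\<close> against \<open>x\<close>.\<close>
      have eq: "(\<Sum>l<L. c l *\<^sub>R e l) - x = (\<Sum>l<L. (c l - (\<Sum>k<K. a k l)) *\<^sub>R e l)
          + (((\<Sum>l<L. coord e s l *\<^sub>R e l) - s) + (s - x))"
        by (simp only: cs[symmetric] scaleR_left_diff_distrib sum_subtractf) simp
      have "psum i ((\<Sum>l<L. c l *\<^sub>R e l) - x) \<le> psum i (\<Sum>l<L. (c l - (\<Sum>k<K. a k l)) *\<^sub>R e l)
          + (psum i ((\<Sum>l<L. coord e s l *\<^sub>R e l) - s) + psum i (s - x))"
        unfolding eq
        by (rule order_trans[OF seminorm_add[OF seminorm_psum] add_left_mono[OF seminorm_add[OF seminorm_psum]]])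
      also have "\<dots> < \<epsilon>/3 + (\<epsilon>/3 + \<epsilon>/3)"
        using tail[of "{..<L}" i K] elim K by (intro add_strict_mono) (auto simp: s_def)
      finally show ?case by simp
    qed
  qed
  then have cx: "coord e x = c" by (rule coord_eqI)
  show ?thesis
  proof (rule usem_leI)
    fix F :: "nat set" assume "finite F"
    then show "psum n (\<Sum>k\<in>F. coord e x k *\<^sub>R e k) \<le> 2"
      using tail[of F n 0] by (simp add: cx)
  qed
qed

text \<open>The open mapping argument. Every small \<open>x\<close> is a sum of terms with \<open>usem (n + k) \<le> 2\<^sup>-\<^sup>k\<close>: as small
  vectors lie in closures of unconditional balls, a term can be subtracted that leaves a
  remainder small enough for the next, smaller ball. By \<open>usem_series\<close> this bounds \<open>usem n x\<close>. The
  index grows with \<open>k\<close> so that the terms are eventually summable for each of the seminorms.\<close>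

lemma usem_le_psum: "\<exists>m M. M > 0 \<and> (\<forall>x. usem n x \<le> M * psum m x)"
proof -
  obtain m d where d: "\<And>i. d i > 0" and md: "\<And>i x. psum (m i) x < d i \<Longrightarrow> in_closed_uball i 1 x"
    using zero_neighbourhood_in_closed_uball by metis
  have md': "in_closed_uball i r x" if "r > 0" "psum (m i) x < d i * r" for i r x
  proof -
    have "psum (m i) ((1/r) *\<^sub>R x) < d i" using that by (simp add: psum_simps field_simps)
    from in_closed_uball_scaleR[OF md[OF this] \<open>r > 0\<close>] show ?thesis using that by simp
  qed
  have bound2: "usem n x \<le> 2" if x: "psum (m n) x < d n" for x
  proof -
    \<comment> \<open>\<open>r\<close> is the remainder before step \<open>k\<close>; the clause for \<open>k = 0\<close> makes the sequence start at \<open>x\<close>.\<close>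
    define P where "P k r \<longleftrightarrow> psum (m (n + k)) r < d (n + k) * (1/2) ^ k \<and> (k = 0 \<longrightarrow> r = x)" for k r
    define R where "R k r r' \<longleftrightarrow> usem (n + k) (r - r') \<le> (1/2) ^ k \<and> psum k r' < (1/2) ^ k" for k r r'
    have "\<exists>f. \<forall>k. P k (f k) \<and> R k (f k) (f (Suc k))"
    proof (rule dependent_nat_choice)
      show "\<exists>r. P 0 r" using x by (auto simp: P_def)
    next
      fix r k assume "P k r"
      then have cl: "in_closed_uball (n + k) ((1/2) ^ k) r" by (intro md') (auto simp: P_def)
      define \<eta> where "\<eta> = min (d (n + Suc k) * (1/2) ^ Suc k) ((1/2) ^ k)"
      define j where "j = max (m (n + Suc k)) k"
      have "\<eta> > 0" using d[of "n + Suc k"] by (simp add: \<eta>_def)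
      then obtain v where v: "usem (n + k) v \<le> (1/2) ^ k" "psum j (r - v) < \<eta>"
        using cl unfolding in_closed_uball_def by blast
      have "psum (m (n + Suc k)) (r - v) < d (n + Suc k) * (1/2) ^ Suc k"
        using v(2) psum_mono[of "m (n + Suc k)" j "r - v"] unfolding \<eta>_def j_def by linarith
      moreover have "psum k (r - v) < (1/2) ^ k"
        using v(2) psum_mono[of k j "r - v"] unfolding \<eta>_def j_def by linarith
      ultimately show "\<exists>r'. P (Suc k) r' \<and> R k r r'"
        using v(1) by (intro exI[of _ "r - v"]) (simp add: P_def R_def)
    qed
    then obtain f where f: "\<And>k. P k (f k)" "\<And>k. R k (f k) (f (Suc k))" by blast
    have f0: "f 0 = x" using f(1)[of 0] by (simp add: P_def)
    show ?thesis
    proof (rule usem_series)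
      show "usem (n + k) (f k - f (Suc k)) \<le> (1/2) ^ k" for k using f(2)[of k] by (simp add: R_def)
      have "(\<lambda>k. f (Suc k)) \<longlonglongrightarrow> 0"
        unfolding tendsto_iff_psum
      proof
        fix i
        show "(\<lambda>k. psum i (f (Suc k) - 0)) \<longlonglongrightarrow> 0"
        proof (rule Lim_null_comparison[of _ "\<lambda>k. (1/2) ^ k"])
          show "\<forall>\<^sub>F k in sequentially. norm (psum i (f (Suc k) - 0)) \<le> (1/2) ^ k"
            using eventually_ge_at_top[of i]
          proof eventually_elim
            case (elim k)
            then show ?case using psum_mono[of i k "f (Suc k)"] f(2)[of k] by (simp add: R_def psum_simps)
          qed
        qed (auto intro!: LIMSEQ_realpow_zero)
      qed
      then have "f \<longlonglongrightarrow> 0" by (simp add: filterlim_sequentially_Suc)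
      then have "(\<lambda>K. x - f K) \<longlonglongrightarrow> x - 0" by (intro tendsto_diff_frechet tendsto_const)
      then show "(\<lambda>K. \<Sum>k<K. f k - f (Suc k)) \<longlonglongrightarrow> x" by (simp add: sum_lessThan_telescope' f0)
    qed
  qed
  \<comment> \<open>\<open>psum (m n) x\<close> may vanish, so \<open>x\<close> is scaled by a quantity slightly larger than it.\<close>
  have "usem n x \<le> 4 / d n * psum (m n) x" for x
  proof (rule field_le_epsilon)
    fix \<epsilon> :: real assume \<epsilon>: "\<epsilon> > 0"
    define c where "c = psum (m n) x + \<epsilon> * d n / 4"
    have c: "c > psum (m n) x" "c > 0"
      using \<epsilon> d[of n] seminorm_nonneg[OF seminorm_psum, of "m n" x] by (auto simp: c_def add_nonneg_pos)
    define y where "y = (d n / (2 * c)) *\<^sub>R x"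
    have "psum (m n) y = d n / (2 * c) * psum (m n) x"
      using c d[of n] by (simp add: y_def psum_simps)
    also have "\<dots> < d n" using c d[of n] seminorm_nonneg[OF seminorm_psum, of "m n" x]
      by (simp add: field_simps)
    finally have "usem n y \<le> 2" by (rule bound2)
    moreover have "x = (2 * c / d n) *\<^sub>R y" using c d[of n] by (simp add: y_def)
    ultimately have "usem n x \<le> 2 * c / d n * 2"
      using usem_scaleR[of n "2 * c / d n" y] c d[of n]
        mult_left_mono[of "usem n y" 2 "2 * c / d n"] by (simp add: abs_of_pos)
    also have "\<dots> = 4 / d n * psum (m n) x + \<epsilon>" using d[of n] by (simp add: c_def field_simps)
    finally show "usem n x \<le> 4 / d n * psum (m n) x + \<epsilon>" .
  qed
  then show ?thesis using d[of n] by (intro exI[of _ "m n"] exI[of _ "4 / d n"]) auto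
qed

lemma coord_le_psum: "\<exists>m M. M > 0 \<and> (\<forall>x. \<bar>coord e x k\<bar> \<le> M * psum m x)"
proof -
  obtain i where i: "psum i (e k) > 0" using basis_psum_pos by blast
  obtain m M where M: "M > 0" "\<And>x. usem i x \<le> M * psum m x" using usem_le_psum by blast
  have "\<bar>coord e x k\<bar> \<le> M / psum i (e k) * psum m x" for x
    using order_trans[OF coord_psum_le_usem[of x k i] M(2)[of x]] i by (simp add: field_simps)
  then show ?thesis using M(1) i by (intro exI[of _ m] exI[of _ "M / psum i (e k)"]) auto
qed

lemma tendsto_coord:
  assumes "(X \<longlongrightarrow> x) F"
  shows "((\<lambda>t. coord e (X t) k) \<longlongrightarrow> coord e x k) F"
proof -
  obtain m M where M: "M > 0" "\<And>x. \<bar>coord e x k\<bar> \<le> M * psum m x" using coord_le_psum by blast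
  have "((\<lambda>t. coord e (X t) k - coord e x k) \<longlongrightarrow> 0) F"
  proof (rule Lim_null_comparison[of _ "\<lambda>t. M * psum m (X t - x)"])
    show "\<forall>\<^sub>F t in F. norm (coord e (X t) k - coord e x k) \<le> M * psum m (X t - x)"
    proof (intro always_eventually allI)
      fix t show "norm (coord e (X t) k - coord e x k) \<le> M * psum m (X t - x)"
        using M(2)[of "X t - x"] by simp
    qed
    show "((\<lambda>t. M * psum m (X t - x)) \<longlongrightarrow> 0) F"
      using assms unfolding tendsto_iff_psum by (intro tendsto_mult_right_zero) auto
  qed
  then show ?thesis by (rule Lim_null[THEN iffD2])
qed

section \<open>Order intervals\<close>

lemma dominated_tail_small:
  assumes "\<epsilon> > 0"
  shows "\<exists>N. \<forall>F c. finite F \<longrightarrow> F \<subseteq> {N..} \<longrightarrow> (\<forall>k. \<bar>c k\<bar> \<le> \<bar>coord e w k\<bar>) \<longrightarrow>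
    psum s (\<Sum>k\<in>F. c k *\<^sub>R e k) < \<epsilon>"
proof -
  obtain N where N: "\<And>F. finite F \<Longrightarrow> F \<subseteq> {N..} \<Longrightarrow> psum s (\<Sum>k\<in>F. coord e w k *\<^sub>R e k) < \<epsilon> / 4"
    using unconditional_tail[of "\<epsilon> / 4" s w] assms by auto
  have "psum s (\<Sum>k\<in>F. c k *\<^sub>R e k) < \<epsilon>"
    if F: "finite F" "F \<subseteq> {N..}" and c: "\<And>k. \<bar>c k\<bar> \<le> \<bar>coord e w k\<bar>" for F c
  proof -
    have "psum s (\<Sum>k\<in>F. c k *\<^sub>R e k) \<le> 2 * (\<epsilon> / 4)"
    proof (rule seminorm_dominated_sum_le[OF seminorm_psum F(1) c])
      fix G assume "G \<subseteq> F"
      then show "psum s (\<Sum>k\<in>G. coord e w k *\<^sub>R e k) \<le> \<epsilon> / 4"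
        using N[of G] F(2) finite_subset[OF _ F(1), of G] by (simp add: subset_trans[of G F])
    qed
    then show ?thesis using assms by simp
  qed
  then show ?thesis by blast
qed

lemma dominated_coords_exist:
  assumes c: "\<And>k. \<bar>c k\<bar> \<le> \<bar>coord e w k\<bar>"
  shows "\<exists>y. \<forall>k. coord e y k = c k"
proof -
  let ?S = "\<lambda>n. \<Sum>k<n. c k *\<^sub>R e k"
  have "\<exists>N. \<forall>m\<ge>N. \<forall>n\<ge>N. psum i (?S m - ?S n) < \<epsilon>" if \<epsilon>: "\<epsilon> > 0" for i \<epsilon>
  proof -
    obtain N where "\<forall>F c. finite F \<longrightarrow> F \<subseteq> {N..} \<longrightarrow> (\<forall>k. \<bar>c k\<bar> \<le> \<bar>coord e w k\<bar>) \<longrightarrow>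
        psum i (\<Sum>k\<in>F. c k *\<^sub>R e k) < \<epsilon>"
      using dominated_tail_small[OF \<epsilon>, of w i] ..
    note N = this[rule_format, OF _ _ c]
    have *: "psum i (?S m - ?S n) < \<epsilon>" if "N \<le> n" "n \<le> m" for m n
    proof -
      have "?S m - ?S n = (\<Sum>k\<in>{n..<m}. c k *\<^sub>R e k)"
        unfolding lessThan_atLeast0 by (rule sum_diff_nat_ivl) (use that in auto)
      moreover have "{n..<m} \<subseteq> {N..}" using that by auto
      ultimately show ?thesis using N[of "{n..<m}"] by simp
    qed
    have "psum i (?S m - ?S n) < \<epsilon>" if "N \<le> n" "N \<le> m" for m n
      using *[of n m] *[of m n] that seminorm_diff_commute[OF seminorm_psum, of i "?S m" "?S n"]
      by (cases "n \<le> m") (simp_all only: nle_le)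
    then show ?thesis by blast
  qed
  from convergentI_psum[of ?S, OF this] obtain y where "?S \<longlonglongrightarrow> y" by blast
  then have "coord e y = c" by (intro coord_eqI) (simp add: sums_def)
  then show ?thesis by auto
qed

lemma tendsto_if_dominated_coords:
  assumes X: "\<And>k. ((\<lambda>t. coord e (X t) k) \<longlongrightarrow> coord e x k) F"
    and dom: "\<forall>\<^sub>F t in F. \<forall>k. \<bar>coord e (X t) k - coord e x k\<bar> \<le> \<bar>coord e w k\<bar>"
  shows "(X \<longlongrightarrow> x) F"
proof (rule tendstoI_psum)
  fix s and \<epsilon> :: real assume \<epsilon>: "\<epsilon> > 0"
  then have \<epsilon>3: "\<epsilon> / 3 > 0" by simp
  obtain N where "\<forall>G c. finite G \<longrightarrow> G \<subseteq> {N..} \<longrightarrow> (\<forall>k. \<bar>c k\<bar> \<le> \<bar>coord e w k\<bar>) \<longrightarrow>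
      psum s (\<Sum>k\<in>G. c k *\<^sub>R e k) < \<epsilon> / 3" using dominated_tail_small[OF \<epsilon>3, of w s] ..
  note N = this[rule_format]
  have "((\<lambda>t. \<Sum>k<N. coord e (X t) k *\<^sub>R e k) \<longlongrightarrow> (\<Sum>k<N. coord e x k *\<^sub>R e k)) F"
    by (intro tendsto_linear_combination X)
  from tendstoD_psum[OF this \<open>\<epsilon> / 3 > 0\<close>, of s] dom
  show "\<forall>\<^sub>F t in F. psum s (X t - x) < \<epsilon>"
  proof eventually_elim
    case (elim t)
    define z where "z = X t - x"
    have "psum s (\<Sum>k<n. coord e z k *\<^sub>R e k) \<le> \<epsilon> / 3 + \<epsilon> / 3" if "n \<ge> N" for n
    proof -
      have "(\<Sum>k<n. coord e z k *\<^sub>R e k) = (\<Sum>k<N. coord e z k *\<^sub>R e k) + (\<Sum>k\<in>{N..<n}. coord e z k *\<^sub>R e k)"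
        by (subst sum.union_disjoint[symmetric]) (use that in \<open>auto intro!: sum.cong\<close>)
      then have "psum s (\<Sum>k<n. coord e z k *\<^sub>R e k)
          \<le> psum s (\<Sum>k<N. coord e z k *\<^sub>R e k) + psum s (\<Sum>k\<in>{N..<n}. coord e z k *\<^sub>R e k)"
        using seminorm_add[OF seminorm_psum] by simp
      moreover have "psum s (\<Sum>k<N. coord e z k *\<^sub>R e k) < \<epsilon> / 3"
        using elim(1) by (simp add: z_def scaleR_left_diff_distrib sum_subtractf)
      moreover have "psum s (\<Sum>k\<in>{N..<n}. coord e z k *\<^sub>R e k) < \<epsilon> / 3"
        using elim(2) by (intro N) (auto simp: z_def)
      ultimately show ?thesis by linarith
    qed
    then have "psum s z \<le> \<epsilon> / 3 + \<epsilon> / 3"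
      by (intro LIMSEQ_le_const2[OF tendsto_psum[OF partial_sums_tendsto]]) blast
    then show ?case using \<epsilon> by (simp add: z_def)
  qed
qed

end

section \<open>Real integration\<close>

text \<open>Completeness of Lebesgue measure makes the exceptional null set harmless.\<close>

lemma borel_measurable_lebesgue_on_AE_LIMSEQ:
  fixes u :: "nat \<Rightarrow> real \<Rightarrow> real"
  assumes S: "S \<in> sets lebesgue" and u: "\<And>n. u n \<in> borel_measurable (lebesgue_on S)"
    and lim: "AE x in lebesgue_on S. (\<lambda>n. u n x) \<longlonglongrightarrow> g x"
  shows "g \<in> borel_measurable (lebesgue_on S)"
proof -
  define h where "h x = lim (\<lambda>n. u n x)" for x
  have "h \<in> borel_measurable (lebesgue_on S)"
    unfolding h_def by (rule borel_measurable_lim_metric[OF u])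
  then have "(\<lambda>x. if x \<in> S then h x else 0) \<in> borel_measurable lebesgue"
    using S by (rule borel_measurable_if_I)
  moreover have "AE x in lebesgue. (if x \<in> S then h x else 0) = (if x \<in> S then g x else 0)"
  proof -
    have "AE x in lebesgue_on S. h x = g x"
      using lim by eventually_elim (simp add: h_def limI)
    then show ?thesis using S by (auto simp: AE_restrict_space_iff)
  qed
  ultimately have "(\<lambda>x. if x \<in> S then g x else 0) \<in> borel_measurable lebesgue"
    by (rule borel_measurable_AE)
  then show ?thesis by (rule borel_measurable_if_D)
qed

text \<open>By Fatou's lemma, letting \<open>m\<close> tend to infinity in \<open>\<integral>\<bar>u n - u m\<bar> < \<epsilon>\<close> gives \<open>\<integral>\<bar>u n - g\<bar> \<le> \<epsilon>\<close>.\<close>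

lemma L1_Cauchy_AE_limit:
  fixes u :: "nat \<Rightarrow> 'm \<Rightarrow> real"
  assumes u: "\<And>n. integrable M (u n)" and g: "g \<in> borel_measurable M"
    and lim: "AE x in M. (\<lambda>n. u n x) \<longlonglongrightarrow> g x"
    and Cauchy: "\<And>\<epsilon>. \<epsilon> > 0 \<Longrightarrow> \<exists>N. \<forall>m\<ge>N. \<forall>n\<ge>N. (\<integral>x. \<bar>u m x - u n x\<bar> \<partial>M) < \<epsilon>"
  shows "integrable M g" and "(\<lambda>n. \<integral>x. u n x \<partial>M) \<longlonglongrightarrow> (\<integral>x. g x \<partial>M)"
proof -
  note [measurable] = g borel_measurable_integrable[OF u]
  have close: "(\<integral>\<^sup>+x. ennreal \<bar>u n x - g x\<bar> \<partial>M) \<le> ennreal \<epsilon>"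
    if N: "\<And>m n. m \<ge> N \<Longrightarrow> n \<ge> N \<Longrightarrow> (\<integral>x. \<bar>u m x - u n x\<bar> \<partial>M) < \<epsilon>" and n: "n \<ge> N" for N n \<epsilon>
  proof -
    have "AE x in M. liminf (\<lambda>m. ennreal \<bar>u n x - u m x\<bar>) = ennreal \<bar>u n x - g x\<bar>"
      using lim
    proof eventually_elim
      case (elim x)
      then have "(\<lambda>m. ennreal \<bar>u n x - u m x\<bar>) \<longlonglongrightarrow> ennreal \<bar>u n x - g x\<bar>"
        by (intro tendsto_ennrealI tendsto_rabs tendsto_diff tendsto_const)
      then show ?case by (rule lim_imp_Liminf[OF sequentially_bot])
    qed
    then have "(\<integral>\<^sup>+x. ennreal \<bar>u n x - g x\<bar> \<partial>M) = (\<integral>\<^sup>+x. liminf (\<lambda>m. ennreal \<bar>u n x - u m x\<bar>) \<partial>M)"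
      by (intro nn_integral_cong_AE) auto
    also have "\<dots> \<le> liminf (\<lambda>m. \<integral>\<^sup>+x. ennreal \<bar>u n x - u m x\<bar> \<partial>M)"
      by (rule nn_integral_liminf) measurable
    also have "\<dots> \<le> limsup (\<lambda>m. \<integral>\<^sup>+x. ennreal \<bar>u n x - u m x\<bar> \<partial>M)"
      by (rule Liminf_le_Limsup) simp
    also have "\<dots> \<le> ennreal \<epsilon>"
    proof (rule Limsup_bounded)
      show "\<forall>\<^sub>F m in sequentially. (\<integral>\<^sup>+x. ennreal \<bar>u n x - u m x\<bar> \<partial>M) \<le> ennreal \<epsilon>"
        using eventually_ge_at_top[of N]
      proof eventually_elim
        case (elim m)
        have "(\<integral>\<^sup>+x. ennreal \<bar>u n x - u m x\<bar> \<partial>M) = ennreal (\<integral>x. \<bar>u n x - u m x\<bar> \<partial>M)"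
          by (rule nn_integral_eq_integral)
            (simp_all add: integrable_abs Bochner_Integration.integrable_diff u)
        then show ?case using N[OF n elim] by (simp add: ennreal_leI less_imp_le)
      qed
    qed
    finally show ?thesis .
  qed
  have int: "integrable M (\<lambda>x. u n x - g x)" and le: "(\<integral>x. \<bar>u n x - g x\<bar> \<partial>M) \<le> \<epsilon>"
    if N: "\<And>m n. m \<ge> N \<Longrightarrow> n \<ge> N \<Longrightarrow> (\<integral>x. \<bar>u m x - u n x\<bar> \<partial>M) < \<epsilon>" and n: "n \<ge> N" and \<epsilon>: "\<epsilon> > 0" for N n \<epsilon>
  proof -
    note c = close[OF N n, simplified]
    show i: "integrable M (\<lambda>x. u n x - g x)"
      unfolding integrable_iff_bounded
    proof
      have "(\<integral>\<^sup>+x. ennreal (norm (u n x - g x)) \<partial>M) \<le> ennreal \<epsilon>" using c by simp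
      then show "(\<integral>\<^sup>+x. ennreal (norm (u n x - g x)) \<partial>M) < \<infinity>"
        using le_less_trans[OF _ ennreal_less_top] by simp
    qed measurable
    have "(\<integral>\<^sup>+x. ennreal \<bar>u n x - g x\<bar> \<partial>M) = ennreal (\<integral>x. \<bar>u n x - g x\<bar> \<partial>M)"
      by (rule nn_integral_eq_integral) (simp_all add: integrable_abs i)
    then show "(\<integral>x. \<bar>u n x - g x\<bar> \<partial>M) \<le> \<epsilon>" using c \<epsilon> by (simp add: ennreal_le_iff)
  qed
  obtain N1 where "\<And>m n. m \<ge> N1 \<Longrightarrow> n \<ge> N1 \<Longrightarrow> (\<integral>x. \<bar>u m x - u n x\<bar> \<partial>M) < 1"
    using Cauchy[of 1] by auto
  from int[OF this, of N1] have "integrable M (\<lambda>x. u N1 x - g x)" by simp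
  from Bochner_Integration.integrable_diff[OF u[of N1] this] show ig: "integrable M g" by simp
  show "(\<lambda>n. \<integral>x. u n x \<partial>M) \<longlonglongrightarrow> (\<integral>x. g x \<partial>M)"
  proof (rule LIMSEQ_I)
    fix r :: real assume "r > 0"
    then have r2: "r/2 > 0" by simp
    from Cauchy[OF this] obtain N where
      N: "\<And>m n. m \<ge> N \<Longrightarrow> n \<ge> N \<Longrightarrow> (\<integral>x. \<bar>u m x - u n x\<bar> \<partial>M) < r/2" by blast
    have "norm ((\<integral>x. u n x \<partial>M) - (\<integral>x. g x \<partial>M)) < r" if n: "n \<ge> N" for n
    proof -
      have "(\<integral>x. u n x \<partial>M) - (\<integral>x. g x \<partial>M) = (\<integral>x. u n x - g x \<partial>M)"
        by (simp add: u ig)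
      then have "norm ((\<integral>x. u n x \<partial>M) - (\<integral>x. g x \<partial>M)) \<le> (\<integral>x. \<bar>u n x - g x\<bar> \<partial>M)"
        using integral_norm_bound[of M "\<lambda>x. u n x - g x"] by simp
      also have "\<dots> \<le> r/2" by (rule le[OF N n r2])
      finally show ?thesis using \<open>r > 0\<close> by simp
    qed
    then show "\<exists>N. \<forall>n\<ge>N. norm ((\<integral>x. u n x \<partial>M) - (\<integral>x. g x \<partial>M)) < r" by blast
  qed
qed

lemma (in finite_measure) simple_bochner_integrable_simple_function:
  "simple_function M h \<Longrightarrow> Bochner_Integration.simple_bochner_integrable M h"
  by (rule simple_bochner_integrable.intros) (simp_all add: emeasure_finite)

lemma (in finite_measure) integrable_simple_function_real:
  fixes h :: "'a \<Rightarrow> real"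
  shows "simple_function M h \<Longrightarrow> integrable M h"
  by (rule integrableI_simple_bochner_integrable[OF simple_bochner_integrable_simple_function])

section \<open>The Frechet-space integral\<close>

context unconditional_frechet
begin

lemma psum_simple_bochner_integral_le:
  assumes "finite_measure M" and h: "simple_function M h"
  shows "psum i (Bochner_Integration.simple_bochner_integral M h) \<le> (\<integral>t. psum i (h t) \<partial>M)"
proof -
  interpret finite_measure M by fact
  have sp: "simple_function M (\<lambda>t. psum i (h t))" using h by (rule simple_function_compose1)
  have "psum i (Bochner_Integration.simple_bochner_integral M h)
      \<le> (\<Sum>y\<in>h ` space M. psum i (measure M {x\<in>space M. h x = y} *\<^sub>R y))"
    unfolding simple_bochner_integral_def by (rule seminorm_sum[OF seminorm_psum])
  also have "\<dots> = (\<Sum>y\<in>h ` space M. measure M {x\<in>space M. h x = y} *\<^sub>R psum i y)"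
    by (simp add: psum_simps)
  also have "\<dots> = Bochner_Integration.simple_bochner_integral M (\<lambda>t. psum i (h t))"
    by (rule simple_bochner_integral_partition[symmetric,
          OF simple_bochner_integrable_simple_function[OF sp] h]) simp_all
  also have "\<dots> = (\<integral>t. psum i (h t) \<partial>M)"
    by (rule simple_bochner_integrable_eq_integral[OF simple_bochner_integrable_simple_function[OF sp]])
  finally show ?thesis .
qed

lemma approx_by_steps_Cauchy:
  assumes h: "approx_by_steps p S g h" and S: "S \<in> lmeasurable" and \<epsilon>: "\<epsilon> > 0"
  shows "\<exists>N. \<forall>m\<ge>N. \<forall>n\<ge>N. (\<integral>t. psum i (h m t - h n t) \<partial>lebesgue_on S) < \<epsilon>"
proof -
  interpret finite_measure "lebesgue_on S" using S by (rule finite_measure_lebesgue_on)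
  have sf: "simple_function (lebesgue_on S) (h n)" for n using h by (simp add: approx_by_steps_def)
  have int: "integrable (lebesgue_on S) (\<lambda>t. p s (h m t - h n t))" for s m n
    by (intro integrable_simple_function_real simple_function_compose2[OF sf sf])
  have "((\<lambda>(m, n). \<integral>t. p s (h m t - h n t) \<partial>lebesgue_on S) \<longlongrightarrow> 0) (sequentially \<times>\<^sub>F sequentially)" for s
    using h by (simp add: approx_by_steps_def)
  then have "((\<lambda>z. \<Sum>s\<le>i. case z of (m, n) \<Rightarrow> \<integral>t. p s (h m t - h n t) \<partial>lebesgue_on S) \<longlongrightarrow> (\<Sum>s\<le>i. 0))
      (sequentially \<times>\<^sub>F sequentially)" by (intro tendsto_sum)
  then have "\<forall>\<^sub>F z in sequentially \<times>\<^sub>F sequentially.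
      (\<Sum>s\<le>i. case z of (m, n) \<Rightarrow> \<integral>t. p s (h m t - h n t) \<partial>lebesgue_on S) < \<epsilon>"
    by (rule order_tendstoD(2)) (use \<epsilon> in simp)
  then have "\<exists>N. \<forall>m\<ge>N. \<forall>n\<ge>N. (\<Sum>s\<le>i. \<integral>t. p s (h m t - h n t) \<partial>lebesgue_on S) < \<epsilon>"
    unfolding eventually_prod_sequentially by auto
  then show ?thesis
    unfolding psum_def by (simp add: int)
qed

text \<open>A Lipschitz function \<open>\<phi>\<close> turns approximating step functions into a real \<open>L\<^sup>1\<close>-Cauchy sequence.
  The cases of interest are the coordinates and the seminorms.\<close>

lemma approx_by_steps_lipschitz:
  fixes \<phi> :: "'a \<Rightarrow> real"
  assumes h: "approx_by_steps p S g h" and S: "S \<in> lmeasurable"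
    and lip: "\<And>x y. \<bar>\<phi> x - \<phi> y\<bar> \<le> L * psum i (x - y)" and L: "L > 0"
  shows "integrable (lebesgue_on S) (\<lambda>t. \<phi> (g t))"
    and "(\<lambda>n. \<integral>t. \<phi> (h n t) \<partial>lebesgue_on S) \<longlonglongrightarrow> (\<integral>t. \<phi> (g t) \<partial>lebesgue_on S)"
proof -
  interpret finite_measure "lebesgue_on S" using S by (rule finite_measure_lebesgue_on)
  have sf: "simple_function (lebesgue_on S) (h n)" for n using h by (simp add: approx_by_steps_def)
  have int: "integrable (lebesgue_on S) (\<lambda>t. \<phi> (h n t))" for n
    by (intro integrable_simple_function_real simple_function_compose1[OF sf])
  have intp: "integrable (lebesgue_on S) (\<lambda>t. psum i (h m t - h n t))" for m n
    by (intro integrable_simple_function_real simple_function_compose2[OF sf sf])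
  have lim: "AE t in lebesgue_on S. (\<lambda>n. \<phi> (h n t)) \<longlonglongrightarrow> \<phi> (g t)"
  proof -
    have "AE t in lebesgue_on S. (\<lambda>n. h n t) \<longlonglongrightarrow> g t" using h by (simp add: approx_by_steps_def)
    then show ?thesis
    proof eventually_elim
      case (elim t)
      then have "(\<lambda>n. L * psum i (h n t - g t)) \<longlonglongrightarrow> 0"
        unfolding tendsto_iff_psum by (intro tendsto_mult_right_zero) auto
      then have "(\<lambda>n. \<phi> (h n t) - \<phi> (g t)) \<longlonglongrightarrow> 0"
        by (rule Lim_null_comparison[rotated]) (simp add: lip)
      then show ?case by (rule Lim_null[THEN iffD2])
    qed
  qed
  have meas: "(\<lambda>t. \<phi> (g t)) \<in> borel_measurable (lebesgue_on S)"
    by (rule borel_measurable_lebesgue_on_AE_LIMSEQ[OF fmeasurableD[OF S] borel_measurable_integrable[OF int] lim])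
  have Cauchy: "\<exists>N. \<forall>m\<ge>N. \<forall>n\<ge>N. (\<integral>t. \<bar>\<phi> (h m t) - \<phi> (h n t)\<bar> \<partial>lebesgue_on S) < \<epsilon>" if "\<epsilon> > 0" for \<epsilon>
  proof -
    have "\<epsilon> / L > 0" using that L by simp
    from approx_by_steps_Cauchy[OF h S this, of i] obtain N where
      N: "\<And>m n. m \<ge> N \<Longrightarrow> n \<ge> N \<Longrightarrow> (\<integral>t. psum i (h m t - h n t) \<partial>lebesgue_on S) < \<epsilon> / L" by blast
    have "(\<integral>t. \<bar>\<phi> (h m t) - \<phi> (h n t)\<bar> \<partial>lebesgue_on S) < \<epsilon>" if "m \<ge> N" "n \<ge> N" for m n
    proof -
      have "(\<integral>t. \<bar>\<phi> (h m t) - \<phi> (h n t)\<bar> \<partial>lebesgue_on S)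
          \<le> (\<integral>t. L * psum i (h m t - h n t) \<partial>lebesgue_on S)"
        by (intro integral_mono integrable_abs Bochner_Integration.integrable_diff int
            integrable_mult_right intp lip)
      also have "\<dots> = L * (\<integral>t. psum i (h m t - h n t) \<partial>lebesgue_on S)" by simp
      also have "\<dots> < L * (\<epsilon> / L)" using N[OF that] L by (intro mult_strict_left_mono)
      finally show ?thesis using L by simp
    qed
    then show ?thesis by blast
  qed
  show "integrable (lebesgue_on S) (\<lambda>t. \<phi> (g t))"
    and "(\<lambda>n. \<integral>t. \<phi> (h n t) \<partial>lebesgue_on S) \<longlonglongrightarrow> (\<integral>t. \<phi> (g t) \<partial>lebesgue_on S)"
    using L1_Cauchy_AE_limit[OF int meas lim Cauchy] by blast+
qed

lemma approx_by_steps_coord: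
  assumes h: "approx_by_steps p S g h" and S: "S \<in> lmeasurable"
  shows "integrable (lebesgue_on S) (\<lambda>t. coord e (g t) k)"
    and "(\<lambda>n. \<integral>t. coord e (h n t) k \<partial>lebesgue_on S) \<longlonglongrightarrow> (\<integral>t. coord e (g t) k \<partial>lebesgue_on S)"
proof -
  obtain m M where M: "M > 0" "\<And>x. \<bar>coord e x k\<bar> \<le> M * psum m x" using coord_le_psum by blast
  have "\<bar>coord e x k - coord e y k\<bar> \<le> M * psum m (x - y)" for x y using M(2)[of "x - y"] by simp
  from approx_by_steps_lipschitz[where \<phi> = "\<lambda>x. coord e x k", OF h S this M(1)]
  show "integrable (lebesgue_on S) (\<lambda>t. coord e (g t) k)"
    and "(\<lambda>n. \<integral>t. coord e (h n t) k \<partial>lebesgue_on S) \<longlonglongrightarrow> (\<integral>t. coord e (g t) k \<partial>lebesgue_on S)"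
    by blast+
qed

lemma approx_by_steps_integral_convergent:
  assumes h: "approx_by_steps p S g h" and S: "S \<in> lmeasurable"
  shows "\<exists>y. (\<lambda>n. Bochner_Integration.simple_bochner_integral (lebesgue_on S) (h n)) \<longlonglongrightarrow> y"
proof (rule convergentI_psum)
  fix i and \<epsilon> :: real assume "\<epsilon> > 0"
  interpret finite_measure "lebesgue_on S" using S by (rule finite_measure_lebesgue_on)
  have sf: "simple_function (lebesgue_on S) (h n)" for n using h by (simp add: approx_by_steps_def)
  have "psum i (Bochner_Integration.simple_bochner_integral (lebesgue_on S) (h m) - Bochner_Integration.simple_bochner_integral (lebesgue_on S) (h n))
      \<le> (\<integral>t. psum i (h m t - h n t) \<partial>lebesgue_on S)" for m n
    using psum_simple_bochner_integral_le[OF finite_measure_axioms simple_function_compose2[OF sf sf], of i "(-)" m n]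
    by (simp add: simple_bochner_integral_diff simple_bochner_integrable_simple_function sf)
  then show "\<exists>N. \<forall>m\<ge>N. \<forall>n\<ge>N. psum i (Bochner_Integration.simple_bochner_integral (lebesgue_on S) (h m)
      - Bochner_Integration.simple_bochner_integral (lebesgue_on S) (h n)) < \<epsilon>"
    using approx_by_steps_Cauchy[OF h S \<open>\<epsilon> > 0\<close>, of i] by (meson le_less_trans)
qed

lemma approx_by_steps_coord_integral:
  assumes h: "approx_by_steps p S g h" and S: "S \<in> lmeasurable"
    and y: "(\<lambda>n. Bochner_Integration.simple_bochner_integral (lebesgue_on S) (h n)) \<longlonglongrightarrow> y"
  shows "coord e y k = (\<integral>t. coord e (g t) k \<partial>lebesgue_on S)"
proof (rule LIMSEQ_unique)
  interpret finite_measure "lebesgue_on S" using S by (rule finite_measure_lebesgue_on)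
  have sf: "simple_function (lebesgue_on S) (h n)" for n using h by (simp add: approx_by_steps_def)
  have lin: "linear (\<lambda>x. coord e x k)" by (rule linearI) auto
  have "coord e (Bochner_Integration.simple_bochner_integral (lebesgue_on S) (h n)) k = (\<integral>t. coord e (h n t) k \<partial>lebesgue_on S)" for n
  proof -
    have "coord e (Bochner_Integration.simple_bochner_integral (lebesgue_on S) (h n)) k
        = Bochner_Integration.simple_bochner_integral (lebesgue_on S) (\<lambda>t. coord e (h n t) k)"
      by (rule simple_bochner_integral_linear[OF lin simple_bochner_integrable_simple_function[OF sf], symmetric])
    also have "\<dots> = (\<integral>t. coord e (h n t) k \<partial>lebesgue_on S)"
      by (intro simple_bochner_integrable_eq_integral simple_bochner_integrable_simple_function
          simple_function_compose1[OF sf])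
    finally show ?thesis .
  qed
  then show "(\<lambda>n. \<integral>t. coord e (h n t) k \<partial>lebesgue_on S) \<longlonglongrightarrow> coord e y k"
    using tendsto_coord[OF y, of k] by simp
  show "(\<lambda>n. \<integral>t. coord e (h n t) k \<partial>lebesgue_on S) \<longlonglongrightarrow> (\<integral>t. coord e (g t) k \<partial>lebesgue_on S)"
    by (rule approx_by_steps_coord(2)[OF h S])
qed

text \<open>The limit of the integrals of the step functions has the coordinates \<open>\<integral>coord e (g t) k\<close>, which
  do not mention the step functions. So the limit does not depend on their choice, and the
  definite description in \<open>frechet_integral\<close> is justified.\<close>

lemma frechet_integrable_imp_integrable:
  assumes "frechet_integrable p S g" and S: "S \<in> lmeasurable"
  shows integrable_coord: "integrable (lebesgue_on S) (\<lambda>t. coord e (g t) k)"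
    and integrable_psum: "integrable (lebesgue_on S) (\<lambda>t. psum i (g t))"
    and coord_frechet_integral: "coord e (frechet_integral p S g) k = (\<integral>t. coord e (g t) k \<partial>lebesgue_on S)"
proof -
  obtain h where h: "approx_by_steps p S g h" using assms(1) by (auto simp: frechet_integrable_def)
  show "integrable (lebesgue_on S) (\<lambda>t. coord e (g t) k)" by (rule approx_by_steps_coord(1)[OF h S])
  show "integrable (lebesgue_on S) (\<lambda>t. psum i (g t))"
    using approx_by_steps_lipschitz(1)[OF h S, of "psum i" 1 i] seminorm_abs_diff[OF seminorm_psum, of i] by simp
  obtain y where y: "(\<lambda>n. Bochner_Integration.simple_bochner_integral (lebesgue_on S) (h n)) \<longlonglongrightarrow> y"
    using approx_by_steps_integral_convergent[OF h S] by blast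
  have "frechet_integral p S g = y"
    unfolding frechet_integral_def
  proof (rule the_equality)
    show "\<exists>h. approx_by_steps p S g h \<and> (\<lambda>n. Bochner_Integration.simple_bochner_integral (lebesgue_on S) (h n)) \<longlonglongrightarrow> y"
      using h y by blast
  next
    fix y' assume "\<exists>h. approx_by_steps p S g h \<and> (\<lambda>n. Bochner_Integration.simple_bochner_integral (lebesgue_on S) (h n)) \<longlonglongrightarrow> y'"
    then obtain h' where h': "approx_by_steps p S g h'"
        "(\<lambda>n. Bochner_Integration.simple_bochner_integral (lebesgue_on S) (h' n)) \<longlonglongrightarrow> y'" by blast
    show "y' = y"
      by (rule ext_coord)
        (simp add: approx_by_steps_coord_integral[OF h'(1) S h'(2)] approx_by_steps_coord_integral[OF h S y])
  qed
  then show "coord e (frechet_integral p S g) k = (\<integral>t. coord e (g t) k \<partial>lebesgue_on S)"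
    by (simp add: approx_by_steps_coord_integral[OF h S y])
qed

text \<open>Each coordinate of \<open>g\<close> is approximated by simple functions bounded by twice its modulus, and the
  \<open>n\<close>-th step function combines the \<open>n\<close>-th approximations of the first \<open>n\<close> coordinates. It
  is dominated by a multiple of \<open>g\<close>, so it converges to \<open>g\<close> pointwise, and the integrable bound for \<open>usem\<close>
  allows dominated convergence.\<close>

lemma frechet_integrableI:
  assumes S: "S \<in> lmeasurable"
    and meas: "\<And>k. (\<lambda>t. coord e (g t) k) \<in> borel_measurable (lebesgue_on S)"
    and B: "\<And>i. integrable (lebesgue_on S) (B i)"
    and le: "\<And>i t. t \<in> S \<Longrightarrow> usem i (g t) \<le> B i t"
  shows "frechet_integrable p S g"
proof -
  interpret finite_measure "lebesgue_on S" using S by (rule finite_measure_lebesgue_on)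
  have "\<exists>\<phi>. (\<forall>n. simple_function (lebesgue_on S) (\<phi> n)) \<and>
      (\<forall>t\<in>S. (\<lambda>n. \<phi> n t) \<longlonglongrightarrow> coord e (g t) k) \<and> (\<forall>n. \<forall>t\<in>S. \<bar>\<phi> n t\<bar> \<le> 2 * \<bar>coord e (g t) k\<bar>)" for k
    using borel_measurable_implies_sequence_metric[OF meas[of k], of 0] by (simp add: dist_real_def)
  then obtain \<phi> where sf: "\<And>k n. simple_function (lebesgue_on S) (\<phi> k n)"
    and lim: "\<And>k t. t \<in> S \<Longrightarrow> (\<lambda>n. \<phi> k n t) \<longlonglongrightarrow> coord e (g t) k"
    and bd: "\<And>k n t. t \<in> S \<Longrightarrow> \<bar>\<phi> k n t\<bar> \<le> 2 * \<bar>coord e (g t) k\<bar>"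
    by metis
  define h where "h n t = (\<Sum>k<n. \<phi> k n t *\<^sub>R e k)" for n t
  have coord_h: "coord e (h n t) k = (if k < n then \<phi> k n t else 0)" for n t k
    unfolding h_def by (subst coord_finite_combination) auto
  have sfh: "simple_function (lebesgue_on S) (h n)" for n
    unfolding h_def by (intro simple_function_sum simple_function_compose1[OF sf])
  have dom: "\<bar>coord e (h n t - g t) k\<bar> \<le> \<bar>coord e (3 *\<^sub>R g t) k\<bar>" if "t \<in> S" for n t k
    using bd[OF that, of k n] abs_triangle_ineq4[of "\<phi> k n t" "coord e (g t) k"]
    by (simp add: coord_h abs_mult)
  have conv: "(\<lambda>n. h n t) \<longlonglongrightarrow> g t" if t: "t \<in> S" for t
  proof (rule tendsto_if_dominated_coords[where w = "3 *\<^sub>R g t"])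
    fix k
    show "(\<lambda>n. coord e (h n t) k) \<longlonglongrightarrow> coord e (g t) k"
    proof (rule Lim_transform_eventually[OF lim[OF t]])
      show "\<forall>\<^sub>F n in sequentially. \<phi> k n t = coord e (h n t) k"
        using eventually_gt_at_top[of k] by eventually_elim (simp add: coord_h)
    qed
  qed (use dom[OF t] in simp)
  have bound: "psum s (h n t - g t) \<le> 6 * B s t" if t: "t \<in> S" for s n t
  proof -
    have "psum s (h n t - g t) \<le> usem s (h n t - g t)" by (rule psum_le_usem)
    also have "\<dots> \<le> 2 * usem s (3 *\<^sub>R g t)" by (rule usem_dominated[OF dom[OF t]])
    also have "\<dots> \<le> 2 * (3 * usem s (g t))" using usem_scaleR[of s 3 "g t"] by simp
    also have "\<dots> \<le> 6 * B s t" using le[OF t, of s] by simp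
    finally show ?thesis .
  qed
  have meas_diff: "(\<lambda>t. psum s (h n t - g t)) \<in> borel_measurable (lebesgue_on S)" for s n
  proof (rule borel_measurable_LIMSEQ_real)
    show "(\<lambda>m. psum s (h n t - h m t)) \<longlonglongrightarrow> psum s (h n t - g t)" if "t \<in> space (lebesgue_on S)" for t
      using that by (intro tendsto_psum tendsto_diff_frechet tendsto_const conv) simp
    show "(\<lambda>t. psum s (h n t - h m t)) \<in> borel_measurable (lebesgue_on S)" for m
      by (intro borel_measurable_simple_function simple_function_compose2[OF sfh sfh])
  qed
  define I where "I s n = (\<integral>t. psum s (h n t - g t) \<partial>lebesgue_on S)" for s n
  have int: "integrable (lebesgue_on S) (\<lambda>t. psum s (h n t - g t))" for s n
  proof (rule Bochner_Integration.integrable_bound[OF integrable_mult_right[where c = 6, OF B[of s]] meas_diff])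
    show "AE t in lebesgue_on S. norm (psum s (h n t - g t)) \<le> norm (6 * B s t)"
      using bound[of _ s n] by (intro AE_I2) (simp add: psum_simps order_trans[OF _ abs_ge_self])
  qed
  have I: "I s \<longlonglongrightarrow> 0" for s
  proof -
    have "(\<lambda>n. \<integral>t. psum s (h n t - g t) \<partial>lebesgue_on S) \<longlonglongrightarrow> (\<integral>t. 0 \<partial>lebesgue_on S)"
    proof (rule integral_dominated_convergence[where w = "\<lambda>t. 6 * B s t"])
      show "integrable (lebesgue_on S) (\<lambda>t. 6 * B s t)" using B by simp
      show "AE t in lebesgue_on S. (\<lambda>n. psum s (h n t - g t)) \<longlonglongrightarrow> 0"
        using conv by (intro AE_I2) (simp add: tendsto_iff_psum)
      show "AE t in lebesgue_on S. norm (psum s (h n t - g t)) \<le> 6 * B s t" for n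
        using bound by (intro AE_I2) (simp add: psum_simps)
    qed (use meas_diff in auto)
    then show ?thesis by (simp add: I_def[abs_def])
  qed
  have diff_le: "(\<integral>t. p s (h m t - h n t) \<partial>lebesgue_on S) \<le> I s m + I s n" for s m n
  proof -
    have "(\<integral>t. p s (h m t - h n t) \<partial>lebesgue_on S)
        \<le> (\<integral>t. psum s (h m t - g t) + psum s (h n t - g t) \<partial>lebesgue_on S)"
    proof (rule integral_mono)
      show "integrable (lebesgue_on S) (\<lambda>t. p s (h m t - h n t))"
        by (intro integrable_simple_function_real simple_function_compose2[OF sfh sfh])
      show "p s (h m t - h n t) \<le> psum s (h m t - g t) + psum s (h n t - g t)" for t
        using order_trans[OF le_psum seminorm_diff[OF seminorm_psum], of s "h m t - g t" "h n t - g t"] by simp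
    qed (intro Bochner_Integration.integrable_add int)
    then show ?thesis by (simp add: I_def int)
  qed
  have "((\<lambda>(m, n). \<integral>t. p s (h m t - h n t) \<partial>lebesgue_on S) \<longlongrightarrow> 0) (sequentially \<times>\<^sub>F sequentially)" for s
  proof (rule tendstoI)
    fix \<epsilon> :: real assume "\<epsilon> > 0"
    then have "\<forall>\<^sub>F n in sequentially. I s n < \<epsilon> / 2" using order_tendstoD(2)[OF I[of s], of "\<epsilon> / 2"] by simp
    then obtain N where N: "\<And>n. n \<ge> N \<Longrightarrow> I s n < \<epsilon> / 2" by (auto simp: eventually_sequentially)
    have *: "dist (\<integral>t. p s (h m t - h n t) \<partial>lebesgue_on S) 0 < \<epsilon>" if "m \<ge> N" "n \<ge> N" for m n
    proof -
      have "0 \<le> (\<integral>t. p s (h m t - h n t) \<partial>lebesgue_on S)"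
        by (rule Bochner_Integration.integral_nonneg) (rule seminorm_nonneg[OF seminorm])
      then show ?thesis using diff_le[of s m n] N[OF that(1)] N[OF that(2)] by simp
    qed
    show "\<forall>\<^sub>F z in sequentially \<times>\<^sub>F sequentially.
        dist (case z of (m, n) \<Rightarrow> \<integral>t. p s (h m t - h n t) \<partial>lebesgue_on S) 0 < \<epsilon>"
      unfolding eventually_prod_sequentially
      by (intro exI[of _ N] allI impI) (use * in simp)
  qed
  moreover have "AE t in lebesgue_on S. (\<lambda>n. h n t) \<longlonglongrightarrow> g t" by (rule AE_I2) (simp add: conv)
  ultimately show ?thesis
    unfolding frechet_integrable_def approx_by_steps_def using sfh by blast
qed

end

section \<open>Dyadic nodes\<close>

text \<open>The dyadic interval of length \<open>1 / 2 ^ n\<close> that contains \<open>t\<close> has the left end \<open>j / 2 ^ n\<close> for this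
  index \<open>j\<close>.\<close>

definition dyadic_index :: "nat \<Rightarrow> real \<Rightarrow> nat" where
  "dyadic_index n t = nat \<lfloor>2 ^ n * t\<rfloor>"

definition lower_node :: "nat \<Rightarrow> nat \<Rightarrow> real" where
  "lower_node n j = real j / 2 ^ n"

lemma dyadic_index_bounds:
  assumes "0 \<le> t"
  shows "real (dyadic_index n t) \<le> 2 ^ n * t" and "2 ^ n * t < real (dyadic_index n t) + 1"
proof -
  have "0 \<le> \<lfloor>2 ^ n * t\<rfloor>" using assms by simp
  then have eq: "real (dyadic_index n t) = of_int \<lfloor>2 ^ n * t\<rfloor>" by (simp add: dyadic_index_def)
  show "real (dyadic_index n t) \<le> 2 ^ n * t" "2 ^ n * t < real (dyadic_index n t) + 1"
    unfolding eq by linarith+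
qed

lemma dyadic_index_Suc:
  assumes "0 \<le> t"
  shows "2 * dyadic_index n t \<le> dyadic_index (Suc n) t"
    and "dyadic_index (Suc n) t \<le> 2 * dyadic_index n t + 1"
proof -
  have "real (2 * dyadic_index n t) < real (dyadic_index (Suc n) t) + 1"
    using dyadic_index_bounds(1)[OF assms, of n] dyadic_index_bounds(2)[OF assms, of "Suc n"] by simp
  then show "2 * dyadic_index n t \<le> dyadic_index (Suc n) t" by linarith
  have "real (dyadic_index (Suc n) t) < real (2 * dyadic_index n t + 1) + 1"
    using dyadic_index_bounds(2)[OF assms, of n] dyadic_index_bounds(1)[OF assms, of "Suc n"] by simp
  then show "dyadic_index (Suc n) t \<le> 2 * dyadic_index n t + 1" by linarith
qed

section \<open>The monotone initial value problem\<close>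

text \<open>The hypotheses on \<open>f\<close> with the bound \<open>C\<close> and the subsolution \<open>xs\<close> fixed. Nonnegative
  coordinates of \<open>C\<close> are no loss: \<open>C\<close> can be replaced by the element with coordinates
  \<open>\<bar>coord e C k\<bar>\<close>, which exists by \<open>dominated_coords_exist\<close>.\<close>

locale monotone_ivp = unconditional_frechet p e
  for p :: "nat \<Rightarrow> 'a::{real_vector, t2_space} \<Rightarrow> real" and e :: "nat \<Rightarrow> 'a" +
  fixes T :: real and x0 :: 'a and f :: "real \<Rightarrow> 'a \<Rightarrow> 'a" and C xs :: 'a
  assumes T_pos: "T > 0"
    and left_cont: "t \<in> {0..T} \<Longrightarrow> left_continuous e (\<lambda>x. coord e (f t x) k)"
    and f_integrable: "frechet_integrable p {0..T} (\<lambda>t. f t x)"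
    and f_le: "t \<in> {0..T} \<Longrightarrow> coord e (f t x) k \<le> coord e C k"
    and C_nonneg: "0 \<le> coord e C k"
    and start: "t \<in> {0..T} \<Longrightarrow> basis_le e xs (x0 + frechet_integral p {0..t} (\<lambda>\<xi>. f \<xi> xs))"
    and f_mono: "t \<in> {0..T} \<Longrightarrow> basis_le e x y \<Longrightarrow> basis_le e (f t x) (f t y)"
begin

definition picard :: "(real \<Rightarrow> 'a) \<Rightarrow> real \<Rightarrow> 'a" where
  "picard X t = x0 + frechet_integral p {0..t} (\<lambda>\<xi>. f \<xi> (X \<xi>))"

text \<open>The functions to which the integral operator can be applied: they lie above \<open>xs\<close>, which confines
  \<open>f t (X t)\<close> to the order interval from \<open>f t xs\<close> to \<open>C\<close>, and their superposition with \<open>f\<close> has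
  measurable coordinates.\<close>

definition admissible :: "(real \<Rightarrow> 'a) \<Rightarrow> bool" where
  "admissible X \<longleftrightarrow> (\<forall>t\<in>{0..T}. basis_le e xs (X t)) \<and>
     (\<forall>k. (\<lambda>t. coord e (f t (X t)) k) \<in> borel_measurable (lebesgue_on {0..T}))"

lemma interval_lmeasurable: "{a..b::real} \<in> lmeasurable"
  using lmeasurable_cbox[of a b] by simp

lemma admissible_lower: "admissible X \<Longrightarrow> t \<in> {0..T} \<Longrightarrow> coord e (f t xs) k \<le> coord e (f t (X t)) k"
  using f_mono[of t xs "X t"] by (simp add: admissible_def basis_le_def)

lemma admissible_dominated:
  assumes "admissible X" "t \<in> {0..T}"
  shows "\<bar>coord e (f t (X t)) k\<bar> \<le> \<bar>coord e (f t xs) k\<bar> + \<bar>coord e C k\<bar>"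
  using admissible_lower[OF assms, of k] f_le[OF assms(2), of "X t" k] by linarith

text \<open>The order interval from \<open>f \<xi> xs\<close> to \<open>C\<close> has an integrable bound for each \<open>usem i\<close>: the distance
  of \<open>f \<xi> (X \<xi>)\<close> from \<open>C\<close> is dominated by that of the integrable function \<open>f \<xi> xs\<close>.\<close>

lemma admissible_integrable:
  assumes X: "admissible X" and t: "t \<in> {0..T}"
  shows "frechet_integrable p {0..t} (\<lambda>\<xi>. f \<xi> (X \<xi>))"
proof -
  have sub: "{0..t} \<subseteq> {0..T}" using t by auto
  have "\<exists>B. integrable (lebesgue_on {0..t}) B \<and> (\<forall>\<xi>\<in>{0..t}. usem i (f \<xi> (X \<xi>)) \<le> B \<xi>)" for i
  proof -
    obtain m L where L: "L > 0" "\<And>x. usem i x \<le> L * psum m x" using usem_le_psum by blast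
    let ?B = "\<lambda>\<xi>. 3 * usem i C + 2 * L * psum m (f \<xi> xs)"
    have "integrable (lebesgue_on {0..T}) (\<lambda>\<xi>. psum m (f \<xi> xs))"
      by (rule integrable_psum[OF f_integrable interval_lmeasurable])
    then have "integrable (lebesgue_on {0..t}) (\<lambda>\<xi>. psum m (f \<xi> xs))"
      using sub by (rule integrable_subinterval)
    moreover have "integrable (lebesgue_on {0..t}) (\<lambda>\<xi>. 3 * usem i C)"
      using finite_measure.integrable_const[OF finite_measure_lebesgue_on[OF interval_lmeasurable]] .
    ultimately have "integrable (lebesgue_on {0..t}) ?B"
      by simp
    moreover have "usem i (f \<xi> (X \<xi>)) \<le> ?B \<xi>" if "\<xi> \<in> {0..t}" for \<xi>
    proof -
      have \<xi>: "\<xi> \<in> {0..T}" using that sub by blast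
      have "usem i (C - f \<xi> (X \<xi>)) \<le> 2 * usem i (C - f \<xi> xs)"
      proof (rule usem_dominated)
        fix k
        show "\<bar>coord e (C - f \<xi> (X \<xi>)) k\<bar> \<le> \<bar>coord e (C - f \<xi> xs) k\<bar>"
          using admissible_lower[OF X \<xi>, of k] f_le[OF \<xi>, of "X \<xi>" k] by simp
      qed
      moreover have "usem i (f \<xi> (X \<xi>)) \<le> usem i C + usem i (C - f \<xi> (X \<xi>))"
        using usem_diff[of i C "C - f \<xi> (X \<xi>)"] by simp
      moreover have "usem i (C - f \<xi> xs) \<le> usem i C + usem i (f \<xi> xs)" by (rule usem_diff)
      ultimately show ?thesis using L(2)[of "f \<xi> xs"] by linarith
    qed
    ultimately show ?thesis by blast
  qed
  then obtain B where B: "\<And>i. integrable (lebesgue_on {0..t}) (B i)"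
      "\<And>i \<xi>. \<xi> \<in> {0..t} \<Longrightarrow> usem i (f \<xi> (X \<xi>)) \<le> B i \<xi>" by metis
  have meas: "(\<lambda>\<xi>. coord e (f \<xi> (X \<xi>)) k) \<in> borel_measurable (lebesgue_on {0..t})" for k
    by (rule measurable_restrict_mono[OF _ sub]) (use X in \<open>simp add: admissible_def\<close>)
  show ?thesis by (rule frechet_integrableI[OF interval_lmeasurable meas B])
qed

lemma picard_coord_lebesgue:
  assumes "admissible X" "t \<in> {0..T}"
  shows "coord e (picard X t) k = coord e x0 k + (\<integral>\<xi>. coord e (f \<xi> (X \<xi>)) k \<partial>lebesgue_on {0..t})"
  by (simp add: picard_def coord_frechet_integral[OF admissible_integrable[OF assms] interval_lmeasurable])

lemma coord_integrable_on:
  assumes "admissible X"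
  shows "(\<lambda>\<xi>. coord e (f \<xi> (X \<xi>)) k) integrable_on {0..T}"
  by (rule integrable_on_lebesgue_on[OF integrable_coord[OF admissible_integrable[OF assms] interval_lmeasurable]])
    (use T_pos in auto)

lemma picard_coord:
  assumes "admissible X" "t \<in> {0..T}"
  shows "coord e (picard X t) k = coord e x0 k + integral {0..t} (\<lambda>\<xi>. coord e (f \<xi> (X \<xi>)) k)"
  unfolding picard_coord_lebesgue[OF assms]
  by (subst lebesgue_integral_eq_integral[OF integrable_coord[OF admissible_integrable[OF assms] interval_lmeasurable]])
    auto

text \<open>Thus \<open>picard X t - t *\<^sub>R C\<close> decreases in \<open>t\<close>. This one-sided bound replaces Lipschitz continuity:
  it keeps \<open>picard X\<close> in an order interval and yields step functions below it.\<close>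

lemma picard_increment:
  assumes X: "admissible X" and st: "0 \<le> s" "s \<le> t" "t \<le> T"
  shows "coord e (picard X t) k - coord e (picard X s) k \<le> (t - s) * coord e C k"
proof -
  let ?g = "\<lambda>\<xi>. coord e (f \<xi> (X \<xi>)) k"
  have int: "?g integrable_on {a..b}" if "0 \<le> a" "b \<le> T" for a b
    by (rule integrable_on_subinterval[OF coord_integrable_on[OF X]]) (use that in auto)
  have "integral {0..s} ?g + integral {s..t} ?g = integral {0..t} ?g"
    using st by (intro Henstock_Kurzweil_Integration.integral_combine int) auto
  moreover have "integral {s..t} ?g \<le> integral {s..t} (\<lambda>_. coord e C k)"
    by (rule integral_le) (use st in \<open>auto intro!: int f_le\<close>)
  ultimately show ?thesis using st by (simp add: picard_coord[OF X])
qed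

lemma picard_0: "admissible X \<Longrightarrow> coord e (picard X 0) k = coord e x0 k"
  using T_pos by (simp add: picard_coord)

lemma picard_upper:
  assumes "admissible X" "t \<in> {0..T}"
  shows "coord e (picard X t) k \<le> coord e (x0 + T *\<^sub>R C) k"
proof -
  have "coord e (picard X t) k \<le> coord e x0 k + t * coord e C k"
    using picard_increment[OF assms(1), of 0 t k] assms(2) picard_0[OF assms(1), of k] by simp
  moreover have "t * coord e C k \<le> T * coord e C k"
    using assms(2) C_nonneg[of k] by (intro mult_right_mono) auto
  ultimately show ?thesis by simp
qed

lemma picard_lower:
  assumes "admissible X" "t \<in> {0..T}"
  shows "coord e (picard X T - T *\<^sub>R C) k \<le> coord e (picard X t) k"
proof -
  have "coord e (picard X T) k \<le> coord e (picard X t) k + (T - t) * coord e C k"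
    using picard_increment[OF assms(1), of t T k] assms(2) by simp
  moreover have "(T - t) * coord e C k \<le> T * coord e C k"
    using assms(2) C_nonneg[of k] by (intro mult_right_mono) auto
  ultimately show ?thesis by simp
qed

text \<open>The coordinates are continuous as indefinite integrals of real functions, and the values stay in
  one order interval.\<close>

lemma continuous_on_picard:
  assumes X: "admissible X"
  shows "continuous_on {0..T} (picard X)"
  unfolding continuous_on_def
proof
  fix t assume t: "t \<in> {0..T}"
  show "(picard X \<longlongrightarrow> picard X t) (at t within {0..T})"
  proof (rule tendsto_if_dominated_coords[where w = "(x0 + T *\<^sub>R C) - (picard X T - T *\<^sub>R C)"])
    fix k
    have "continuous_on {0..T} (\<lambda>t. coord e x0 k + integral {0..t} (\<lambda>\<xi>. coord e (f \<xi> (X \<xi>)) k))"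
      by (intro continuous_on_add continuous_on_const indefinite_integral_continuous_1 coord_integrable_on X)
    then have "continuous_on {0..T} (\<lambda>t. coord e (picard X t) k)"
      by (rule continuous_on_eq) (simp add: picard_coord[OF X])
    then show "((\<lambda>s. coord e (picard X s) k) \<longlongrightarrow> coord e (picard X t) k) (at t within {0..T})"
      using t by (simp add: continuous_on_def)
  next
    have "\<bar>coord e (picard X s) k - coord e (picard X t) k\<bar>
        \<le> \<bar>coord e ((x0 + T *\<^sub>R C) - (picard X T - T *\<^sub>R C)) k\<bar>" if "s \<in> {0..T}" for s k
      using picard_lower[OF X that, of k] picard_upper[OF X that, of k]
        picard_lower[OF X t, of k] picard_upper[OF X t, of k] by simp
    then show "\<forall>\<^sub>F s in at t within {0..T}. \<forall>k. \<bar>coord e (picard X s) k - coord e (picard X t) k\<bar>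
        \<le> \<bar>coord e ((x0 + T *\<^sub>R C) - (picard X T - T *\<^sub>R C)) k\<bar>"
      by (simp add: eventually_at_filter)
  qed
qed

text \<open>The right end of the dyadic interval may exceed \<open>T\<close>, where \<open>picard X\<close> is not controlled.\<close>

definition upper_node :: "nat \<Rightarrow> nat \<Rightarrow> real" where
  "upper_node n j = min T ((real j + 1) / 2 ^ n)"

lemma nodes:
  assumes t: "t \<in> {0..T}"
  shows "lower_node n (dyadic_index n t) \<le> t" "t \<le> upper_node n (dyadic_index n t)"
    and "upper_node n (dyadic_index n t) \<le> T"
    and "upper_node n (dyadic_index n t) - lower_node n (dyadic_index n t) \<le> 1 / 2 ^ n"
    and "lower_node n (dyadic_index n t) \<le> lower_node (Suc n) (dyadic_index (Suc n) t)"
    and "upper_node (Suc n) (dyadic_index (Suc n) t) \<le> upper_node n (dyadic_index n t)"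
proof -
  have t0: "0 \<le> t" using t by simp
  let ?j = "real (dyadic_index n t)" and ?j' = "real (dyadic_index (Suc n) t)"
  note b = dyadic_index_bounds[OF t0, of n]
  have s: "2 * ?j \<le> ?j'" "?j' \<le> 2 * ?j + 1"
    using dyadic_index_Suc[OF t0, of n] by linarith+
  show "lower_node n (dyadic_index n t) \<le> t"
    using b by (simp add: lower_node_def pos_divide_le_eq mult.commute)
  have "t \<le> (?j + 1) / 2 ^ n" using b by (simp add: pos_le_divide_eq mult.commute)
  then show "t \<le> upper_node n (dyadic_index n t)" using t by (simp add: upper_node_def)
  show "upper_node n (dyadic_index n t) \<le> T" by (simp add: upper_node_def)
  have "(?j + 1) / 2 ^ n - ?j / 2 ^ n = 1 / 2 ^ n" by (simp add: add_divide_distrib)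
  then show "upper_node n (dyadic_index n t) - lower_node n (dyadic_index n t) \<le> 1 / 2 ^ n"
    unfolding upper_node_def lower_node_def by linarith
  have "?j / 2 ^ n = 2 * ?j / 2 ^ Suc n" by simp
  also have "\<dots> \<le> ?j' / 2 ^ Suc n" by (rule divide_right_mono[OF s(1)]) simp
  finally show "lower_node n (dyadic_index n t) \<le> lower_node (Suc n) (dyadic_index (Suc n) t)"
    by (simp only: lower_node_def)
  have "(?j' + 1) / 2 ^ Suc n \<le> (2 * ?j + 2) / 2 ^ Suc n"
    by (rule divide_right_mono) (use s(2) in simp_all)
  also have "\<dots> = (2 * (?j + 1)) / (2 * 2 ^ n)" by (simp only: distrib_left power_Suc mult_1_right)
  also have "\<dots> = (?j + 1) / 2 ^ n" by (rule mult_divide_mult_cancel_left) simp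
  finally show "upper_node (Suc n) (dyadic_index (Suc n) t) \<le> upper_node n (dyadic_index n t)"
    unfolding upper_node_def by linarith
qed

text \<open>For fixed \<open>n\<close> the function \<open>y n\<close> takes countably many values, so \<open>f t (y n t)\<close> inherits
  measurability in \<open>t\<close> from \<open>f\<close> with a constant second argument. The sequence \<open>y n t\<close> increases to
  \<open>picard X t\<close>, and left continuity applies.\<close>

lemma measurable_picard_superposition:
  assumes X: "admissible X"
  shows "(\<lambda>t. coord e (f t (picard X t)) k) \<in> borel_measurable (lebesgue_on {0..T})"
proof -
  define v where "v n j = picard X (upper_node n j) - (upper_node n j - lower_node n j) *\<^sub>R C" for n j
  define y where "y n t = v n (dyadic_index n t)" for n t
  have y_tendsto: "(\<lambda>n. y n t) \<longlonglongrightarrow> picard X t" if t: "t \<in> {0..T}" for t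
  proof -
    let ?l = "\<lambda>n. lower_node n (dyadic_index n t)" and ?u = "\<lambda>n. upper_node n (dyadic_index n t)"
    have pow: "(\<lambda>n. 1 / 2 ^ n :: real) \<longlonglongrightarrow> 0"
      using LIMSEQ_realpow_zero[of "1/2"] by (simp add: power_one_over)
    have d: "(\<lambda>n. ?u n - ?l n) \<longlonglongrightarrow> 0"
    proof (rule Lim_null_comparison[OF _ pow])
      have "0 \<le> ?u n - ?l n" for n using nodes(1,2)[OF t, of n] by linarith
      then show "\<forall>\<^sub>F n in sequentially. norm (?u n - ?l n) \<le> 1 / 2 ^ n"
        using nodes(4)[OF t] by simp
    qed
    have "(\<lambda>n. ?u n - t) \<longlonglongrightarrow> 0"
    proof (rule Lim_null_comparison[OF _ pow])
      have "norm (?u n - t) \<le> 1 / 2 ^ n" for n using nodes(1,2,4)[OF t, of n] by simp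
      then show "\<forall>\<^sub>F n in sequentially. norm (?u n - t) \<le> 1 / 2 ^ n" by simp
    qed
    then have "?u \<longlonglongrightarrow> t" by (rule Lim_null[THEN iffD2])
    moreover have "?u n \<in> {0..T}" for n using nodes(2,3)[OF t, of n] t by simp
    ultimately have "(\<lambda>n. picard X (?u n)) \<longlonglongrightarrow> picard X t"
      by (intro continuous_on_tendsto_compose[OF continuous_on_picard[OF X]]) (use t in auto)
    moreover have "(\<lambda>n. (?u n - ?l n) *\<^sub>R C) \<longlonglongrightarrow> 0"
      using tendsto_linear_combination[of "{()}" "\<lambda>_ n. ?u n - ?l n" "\<lambda>_. 0" sequentially "\<lambda>_. C"] d by simp
    ultimately have "(\<lambda>n. picard X (?u n) - (?u n - ?l n) *\<^sub>R C) \<longlonglongrightarrow> picard X t - 0"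
      by (rule tendsto_diff_frechet)
    then show ?thesis by (simp add: y_def v_def)
  qed
  have y_mono: "basis_le e (y n t) (y (Suc n) t)" if t: "t \<in> {0..T}" for n t
    unfolding basis_le_def
  proof
    fix i
    let ?l = "lower_node n (dyadic_index n t)" and ?u = "upper_node n (dyadic_index n t)"
    let ?l' = "lower_node (Suc n) (dyadic_index (Suc n) t)" and ?u' = "upper_node (Suc n) (dyadic_index (Suc n) t)"
    have "0 \<le> ?u'" using nodes(2)[OF t, of "Suc n"] t by simp
    then have 1: "coord e (picard X ?u) i - coord e (picard X ?u') i \<le> (?u - ?u') * coord e C i"
      by (intro picard_increment[OF X] nodes[OF t])
    have 2: "?l * coord e C i \<le> ?l' * coord e C i"
      by (rule mult_right_mono[OF nodes(5)[OF t] C_nonneg])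
    show "coord e (y n t) i \<le> coord e (y (Suc n) t) i"
      using 1 2 by (simp add: y_def v_def algebra_simps)
  qed
  show ?thesis
  proof (rule borel_measurable_LIMSEQ_real)
    fix t assume "t \<in> space (lebesgue_on {0..T})"
    then have t: "t \<in> {0..T}" by simp
    show "(\<lambda>n. coord e (f t (y n t)) k) \<longlonglongrightarrow> coord e (f t (picard X t)) k"
      using left_cont[OF t, of k] y_tendsto[OF t] y_mono[OF t] unfolding left_continuous_def by blast
  next
    fix n
    have "(\<lambda>t. coord e (f t (v n j)) k) \<in> borel_measurable (lebesgue_on {0..T})" for j
      by (rule borel_measurable_integrable[OF integrable_coord[OF f_integrable interval_lmeasurable]])
    moreover have "dyadic_index n \<in> measurable (lebesgue_on {0..T}) (count_space UNIV)"
    proof -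
      have "dyadic_index n \<in> measurable borel (count_space UNIV)"
        unfolding dyadic_index_def by measurable
      then have "dyadic_index n \<in> measurable lebesgue (count_space UNIV)"
        by (intro measurable_completion) simp
      then show ?thesis by (rule measurable_restrict_space1)
    qed
    ultimately show "(\<lambda>t. coord e (f t (y n t)) k) \<in> borel_measurable (lebesgue_on {0..T})"
      unfolding y_def by (rule measurable_compose_countable)
  qed
qed

lemma admissible_picard:
  "admissible X \<Longrightarrow> (\<And>t. t \<in> {0..T} \<Longrightarrow> basis_le e xs (picard X t)) \<Longrightarrow> admissible (picard X)"
  by (simp add: admissible_def[of "picard X"] measurable_picard_superposition)

lemma admissible_xs: "admissible (\<lambda>_. xs)"
  unfolding admissible_def
  by (simp add: basis_le_def borel_measurable_integrable[OF integrable_coord[OF f_integrable interval_lmeasurable]])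

lemma picard_mono:
  assumes X: "admissible X" and Y: "admissible Y" and t: "t \<in> {0..T}"
    and le: "\<And>t. t \<in> {0..T} \<Longrightarrow> basis_le e (X t) (Y t)"
  shows "basis_le e (picard X t) (picard Y t)"
  unfolding basis_le_def
proof
  fix k
  have "integral {0..t} (\<lambda>\<xi>. coord e (f \<xi> (X \<xi>)) k) \<le> integral {0..t} (\<lambda>\<xi>. coord e (f \<xi> (Y \<xi>)) k)"
  proof (rule integral_le)
    show "(\<lambda>\<xi>. coord e (f \<xi> (X \<xi>)) k) integrable_on {0..t}" "(\<lambda>\<xi>. coord e (f \<xi> (Y \<xi>)) k) integrable_on {0..t}"
      by (rule integrable_on_subinterval[OF coord_integrable_on[OF X]], use t in auto)
        (rule integrable_on_subinterval[OF coord_integrable_on[OF Y]], use t in auto)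
    show "coord e (f \<xi> (X \<xi>)) k \<le> coord e (f \<xi> (Y \<xi>)) k" if "\<xi> \<in> {0..t}" for \<xi>
      using f_mono[of \<xi>, OF _ le[of \<xi>]] that t by (simp add: basis_le_def)
  qed
  then show "coord e (picard X t) k \<le> coord e (picard Y t) k"
    by (simp add: picard_coord[OF X t] picard_coord[OF Y t])
qed

definition iterate :: "nat \<Rightarrow> real \<Rightarrow> 'a" where
  "iterate n = (picard ^^ n) (\<lambda>_. xs)"

lemma iterate_0: "iterate 0 = (\<lambda>_. xs)" and iterate_Suc: "iterate (Suc n) = picard (iterate n)"
  by (simp_all add: iterate_def)

lemma basis_le_trans: "basis_le e x y \<Longrightarrow> basis_le e y z \<Longrightarrow> basis_le e x z"
  unfolding basis_le_def by (meson order_trans)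

lemma iterate_admissible_increasing:
  "admissible (iterate n) \<and> (\<forall>t\<in>{0..T}. basis_le e (iterate n t) (iterate (Suc n) t))"
proof (induction n)
  case 0
  show ?case using admissible_xs start by (simp add: iterate_0 iterate_Suc picard_def)
next
  case (Suc n)
  have "basis_le e xs (picard (iterate n) t)" if "t \<in> {0..T}" for t
    using Suc.IH that unfolding iterate_Suc admissible_def by (meson basis_le_trans)
  then have adm: "admissible (iterate (Suc n))"
    unfolding iterate_Suc using Suc.IH by (intro admissible_picard) auto
  moreover have "basis_le e (picard (iterate n) t) (picard (iterate (Suc n)) t)" if "t \<in> {0..T}" for t
    using Suc.IH adm that by (intro picard_mono) auto
  ultimately show ?case by (simp add: iterate_Suc)
qed

lemmas admissible_iterate = iterate_admissible_increasing[THEN conjunct1]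

lemma iterate_increasing: "t \<in> {0..T} \<Longrightarrow> basis_le e (iterate n t) (iterate (Suc n) t)"
  using iterate_admissible_increasing by blast

lemma iterate_bounds:
  assumes t: "t \<in> {0..T}"
  shows "coord e xs k \<le> coord e (iterate n t) k" "coord e (iterate n t) k \<le> coord e (x0 + T *\<^sub>R C) k"
proof -
  show "coord e xs k \<le> coord e (iterate n t) k"
    using admissible_iterate[of n] t by (simp add: admissible_def basis_le_def)
  have "coord e (iterate n t) k \<le> coord e (iterate (Suc n) t) k"
    using iterate_increasing[OF t, of n] by (simp add: basis_le_def)
  also have "\<dots> \<le> coord e (x0 + T *\<^sub>R C) k"
    unfolding iterate_Suc by (rule picard_upper[OF admissible_iterate t])
  finally show "coord e (iterate n t) k \<le> coord e (x0 + T *\<^sub>R C) k" .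
qed

text \<open>Each coordinate is increasing and bounded, and the order interval from \<open>xs\<close> to \<open>x0 + T *\<^sub>R C\<close>
  contains the limit.\<close>

lemma iterate_convergent:
  assumes t: "t \<in> {0..T}"
  shows "\<exists>z. (\<lambda>n. iterate n t) \<longlonglongrightarrow> z"
proof -
  let ?u = "x0 + T *\<^sub>R C"
  have "\<exists>c. (\<lambda>n. coord e (iterate n t) k) \<longlonglongrightarrow> c \<and> (\<forall>n. coord e (iterate n t) k \<le> c)" for k
  proof -
    have "incseq (\<lambda>n. coord e (iterate n t) k)"
      using iterate_increasing[OF t] by (intro incseq_SucI) (simp add: basis_le_def)
    moreover have "\<forall>n. coord e (iterate n t) k \<le> coord e ?u k" using iterate_bounds(2)[OF t] by blast
    ultimately obtain c where "(\<lambda>n. coord e (iterate n t) k) \<longlonglongrightarrow> c" "\<forall>n. coord e (iterate n t) k \<le> c"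
      by (rule incseq_convergent)
    then show ?thesis by blast
  qed
  then obtain c where c: "\<And>k. (\<lambda>n. coord e (iterate n t) k) \<longlonglongrightarrow> c k"
      "\<And>k n. coord e (iterate n t) k \<le> c k" by metis
  have lo: "coord e xs k \<le> c k" for k
    using order_trans[OF iterate_bounds(1)[OF t] c(2)] .
  have hi: "c k \<le> coord e ?u k" for k
    by (rule LIMSEQ_le_const2[OF c(1)]) (use iterate_bounds(2)[OF t] in blast)
  have "\<bar>c k - coord e xs k\<bar> \<le> \<bar>coord e (?u - xs) k\<bar>" for k
    using lo[of k] hi[of k] by simp
  then have "\<exists>z. \<forall>k. coord e z k = c k - coord e xs k"
    by (rule dominated_coords_exist)
  then obtain z where z: "\<And>k. coord e z k = c k - coord e xs k" by blast
  have "(\<lambda>n. iterate n t) \<longlonglongrightarrow> xs + z"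
  proof (rule tendsto_if_dominated_coords[where w = "?u - xs"])
    show "(\<lambda>n. coord e (iterate n t) k) \<longlonglongrightarrow> coord e (xs + z) k" for k
      using c(1)[of k] by (simp add: z)
    have "\<bar>coord e (iterate n t) k - coord e (xs + z) k\<bar> \<le> \<bar>coord e (?u - xs) k\<bar>" for n k
      using lo[of k] hi[of k] iterate_bounds[OF t, where n = n and k = k] by (simp add: z)
    then show "\<forall>\<^sub>F n in sequentially. \<forall>k. \<bar>coord e (iterate n t) k - coord e (xs + z) k\<bar> \<le> \<bar>coord e (?u - xs) k\<bar>"
      by simp
  qed
  then show ?thesis by blast
qed

text \<open>Left continuity applies to the iterates themselves, because they increase to \<open>Z\<close>. So \<open>Z\<close> is
  admissible, and dominated convergence in each coordinate passes to the limit in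
  \<open>iterate (Suc n) = picard (iterate n)\<close>.\<close>

theorem solution_exists: "\<exists>x. ivp_solution p T f x0 x"
proof -
  have "\<forall>t\<in>{0..T}. \<exists>z. (\<lambda>n. iterate n t) \<longlonglongrightarrow> z" using iterate_convergent by blast
  from bchoice[OF this] obtain Z where Z: "\<And>t. t \<in> {0..T} \<Longrightarrow> (\<lambda>n. iterate n t) \<longlonglongrightarrow> Z t" by blast
  have fZ: "(\<lambda>n. coord e (f t (iterate n t)) k) \<longlonglongrightarrow> coord e (f t (Z t)) k" if t: "t \<in> {0..T}" for t k
    using left_cont[OF t, of k] Z[OF t] iterate_increasing[OF t] unfolding left_continuous_def by blast
  have "basis_le e xs (Z t)" if t: "t \<in> {0..T}" for t
    unfolding basis_le_def
  proof
    fix k show "coord e xs k \<le> coord e (Z t) k"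
      by (rule LIMSEQ_le_const[OF tendsto_coord[OF Z[OF t]]]) (use iterate_bounds(1)[OF t] in blast)
  qed
  moreover have "(\<lambda>t. coord e (f t (Z t)) k) \<in> borel_measurable (lebesgue_on {0..T})" for k
  proof (rule borel_measurable_LIMSEQ_real)
    show "(\<lambda>n. coord e (f t (iterate n t)) k) \<longlonglongrightarrow> coord e (f t (Z t)) k"
      if "t \<in> space (lebesgue_on {0..T})" for t using fZ that by simp
    show "(\<lambda>t. coord e (f t (iterate n t)) k) \<in> borel_measurable (lebesgue_on {0..T})" for n
      using admissible_iterate[of n] by (simp add: admissible_def)
  qed
  ultimately have admZ: "admissible Z" by (simp add: admissible_def)
  have fixed_point: "Z t = picard Z t" if t: "t \<in> {0..T}" for t
  proof (rule ext_coord, rule LIMSEQ_unique)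
    fix k
    have sub: "{0..t} \<subseteq> {0..T}" using t by auto
    show "(\<lambda>n. coord e (iterate (Suc n) t) k) \<longlonglongrightarrow> coord e (Z t) k"
      by (rule LIMSEQ_Suc[OF tendsto_coord[OF Z[OF t]]])
    have meas: "(\<lambda>\<xi>. coord e (f \<xi> (X \<xi>)) k) \<in> borel_measurable (lebesgue_on {0..t})" if "admissible X" for X
      by (rule borel_measurable_integrable[OF integrable_coord[OF admissible_integrable[OF that t] interval_lmeasurable]])
    have "(\<lambda>n. \<integral>\<xi>. coord e (f \<xi> (iterate n \<xi>)) k \<partial>lebesgue_on {0..t})
        \<longlonglongrightarrow> (\<integral>\<xi>. coord e (f \<xi> (Z \<xi>)) k \<partial>lebesgue_on {0..t})"
    proof (rule integral_dominated_convergence[where w = "\<lambda>\<xi>. \<bar>coord e (f \<xi> xs) k\<bar> + \<bar>coord e C k\<bar>"])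
      show "integrable (lebesgue_on {0..t}) (\<lambda>\<xi>. \<bar>coord e (f \<xi> xs) k\<bar> + \<bar>coord e C k\<bar>)"
        by (intro Bochner_Integration.integrable_add integrable_abs
            integrable_coord[OF admissible_integrable[OF admissible_xs t] interval_lmeasurable]
            finite_measure.integrable_const[OF finite_measure_lebesgue_on[OF interval_lmeasurable]])
      show "AE \<xi> in lebesgue_on {0..t}. (\<lambda>n. coord e (f \<xi> (iterate n \<xi>)) k) \<longlonglongrightarrow> coord e (f \<xi> (Z \<xi>)) k"
        using fZ sub by (intro AE_I2) auto
      show "AE \<xi> in lebesgue_on {0..t}. norm (coord e (f \<xi> (iterate n \<xi>)) k)
          \<le> \<bar>coord e (f \<xi> xs) k\<bar> + \<bar>coord e C k\<bar>" for n
        using admissible_dominated[OF admissible_iterate[of n]] sub by (intro AE_I2) auto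
    qed (rule meas[OF admZ], rule meas[OF admissible_iterate])
    then show "(\<lambda>n. coord e (iterate (Suc n) t) k) \<longlonglongrightarrow> coord e (picard Z t) k"
      unfolding iterate_Suc picard_coord_lebesgue[OF admissible_iterate t] picard_coord_lebesgue[OF admZ t]
      by (intro tendsto_add tendsto_const)
  qed
  have "continuous_on {0..T} Z"
    using continuous_on_picard[OF admZ] by (rule continuous_on_eq) (simp add: fixed_point[symmetric])
  moreover have "frechet_integrable p {0..T} (\<lambda>t. f t (Z t))"
    by (rule admissible_integrable[OF admZ]) (use T_pos in simp)
  moreover have "\<forall>t\<in>{0..T}. Z t = x0 + frechet_integral p {0..t} (\<lambda>\<xi>. f \<xi> (Z \<xi>))"
    using fixed_point by (simp add: picard_def)
  ultimately show ?thesis unfolding ivp_solution_def by blast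
qed

end

theorem theorem1:
  fixes p :: "nat \<Rightarrow> 'a::{real_vector, t2_space} \<Rightarrow> real"
    and e :: "nat \<Rightarrow> 'a"
    and T :: real
    and x0 :: 'a
    and f :: "real \<Rightarrow> 'a \<Rightarrow> 'a"
  assumes "frechet_space p"
    and "unconditional_schauder_basis e"
    and "T > 0"
    and "\<And>k t. t \<in> {0..T} \<Longrightarrow> left_continuous e (\<lambda>x. coord e (f t x) k)"
    and "\<And>x. frechet_integrable p {0..T} (\<lambda>t. f t x)"
    and "\<exists>C. \<forall>t\<in>{0..T}. \<forall>x. basis_le e (f t x) C"
    and "\<exists>xs. \<forall>t\<in>{0..T}. basis_le e xs (x0 + frechet_integral p {0..t} (\<lambda>\<xi>. f \<xi> xs))"
    and "\<And>x y t. t \<in> {0..T} \<Longrightarrow> basis_le e x y \<Longrightarrow> basis_le e (f t x) (f t y)"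
  shows "\<exists>x. ivp_solution p T f x0 x"
proof -
  interpret unconditional_frechet p e
    using assms(1,2) by (simp add: unconditional_frechet_def unconditional_frechet_axioms_def)
  obtain C where C: "\<And>t x k. t \<in> {0..T} \<Longrightarrow> coord e (f t x) k \<le> coord e C k"
    using assms(6) unfolding basis_le_def by blast
  obtain xs where xs: "\<And>t. t \<in> {0..T} \<Longrightarrow>
      basis_le e xs (x0 + frechet_integral p {0..t} (\<lambda>\<xi>. f \<xi> xs))"
    using assms(7) by blast
  have "\<exists>C'. \<forall>k. coord e C' k = \<bar>coord e C k\<bar>"
    by (rule dominated_coords_exist[of _ C]) simp
  then obtain C' where C': "\<And>k. coord e C' k = \<bar>coord e C k\<bar>" by blast
  interpret monotone_ivp p e T x0 f C' xs
  proof unfold_locales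
    show "coord e (f t x) k \<le> coord e C' k" if "t \<in> {0..T}" for t x k
      using C[OF that, of x k] by (simp add: C')
    show "0 \<le> coord e C' k" for k by (simp add: C')
  qed (use assms(3,4,5,8) xs in blast)+
  show ?thesis by (rule solution_exists)
qed

end
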